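(* For each $k\in\mathbb{N}=\{0,1,2,\dots\}$, the function $\ell\mapsto 2(k+1)\ell$ (from $\mathbb{R}_{\geq0}$ to $\mathbb{R}_{\geq0}$) is a compressing function for the class of graphs of treewidth at most $k$, and also for the class of graphs of pathwidth at most $k$.
   Context: For a graph $A$, an $A$-indexed partition of a graph $G$ is a family $(P_a:a\in V(A))$ of pairwise disjoint (possibly empty) subsets of $V(G)$ with union $V(G)$. For real $\ell\geq0$, it is $\ell$-compressing in $G$ if for all distinct $a,a'\in V(A)$ with $\operatorname{dist}_G(P_a,P_{a'})\leq \ell$ (minimum distance in $G$ between a vertex of $P_a$ and a vertex of $P_{a'}$), $a$ and $a'$ are adjacent in $A$. A function $f:\mathbb{R}_{\geq0}\to\mathbb{R}_{\geq0}$ is a compressing function for a class of graphs $\mathcal{H}$ if for each $\ell\geq 0$ and each $H\in\mathcal{H}$ there exist $A\in\mathcal{H}$ and an $\ell$-compressing $A$-indexed partition of $H$ each of whose parts has weak diameter in $H$ at most $f(\ell)$, where the weak diameter in $H$ of $S\subseteq V(H)$ is the maximum of $\operatorname{dist}_H(u,v)$ over $u,v\in S$. *)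

theory Defs
  imports Complex_Main "HOL-Library.Disjoint_Sets" "Graph_Theory.Graph_Theory"
begin

text \<open>
  Graphs are finite, simple and undirected: they are values \<open>G\<close> of type
  \<open>'a pair_pre_digraph\<close> satisfying \<^const>\<open>pair_graph\<close>, so each edge is represented
  by its two orientations in \<^term>\<open>parcs G\<close>. The null graph is allowed.
\<close>

subsection \<open>Treewidth and pathwidth\<close>

text \<open>
  The library predicate \<^const>\<open>tree\<close> is unsuitable here, because in a symmetric digraph
  the walk \<open>u, v, u\<close> counts as a \<^const>\<open>pre_digraph.cycle\<close>.  Cycles of an undirected
  simple graph are those of length at least 3.
\<close>

definition tree_graph :: "'t pair_pre_digraph \<Rightarrow> bool" where
  "tree_graph T \<longleftrightarrow> pair_graph T \<and> connected (with_proj T) \<and>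
     \<not> (\<exists>p. pre_digraph.cycle (with_proj T) p \<and> 3 \<le> length p)"

definition path_graph :: "'t pair_pre_digraph \<Rightarrow> bool" where
  "path_graph T \<longleftrightarrow> (\<exists>ts. ts \<noteq> [] \<and> distinct ts \<and> pverts T = set ts \<and>
     parcs T = set (vwalk_arcs ts) \<union> (set (vwalk_arcs ts))\<inverse>)"

text \<open>
  \<^const>\<open>connected\<close> includes nonemptiness, so the last condition also says that
  every vertex lies in some bag.
\<close>

definition graph_decomposition ::
  "'a pair_pre_digraph \<Rightarrow> 't pair_pre_digraph \<Rightarrow> ('t \<Rightarrow> 'a set) \<Rightarrow> bool" where
  "graph_decomposition G T B \<longleftrightarrow>
     (\<forall>t\<in>pverts T. B t \<subseteq> pverts G) \<and>
     (\<forall>(u, v)\<in>parcs G. \<exists>t\<in>pverts T. u \<in> B t \<and> v \<in> B t) \<and>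
     (\<forall>v\<in>pverts G. connected (with_proj T \<restriction> {t \<in> pverts T. v \<in> B t}))"

definition tree_decomposition ::
  "'a pair_pre_digraph \<Rightarrow> 't pair_pre_digraph \<Rightarrow> ('t \<Rightarrow> 'a set) \<Rightarrow> bool" where
  "tree_decomposition G T B \<longleftrightarrow> tree_graph T \<and> graph_decomposition G T B"

definition path_decomposition ::
  "'a pair_pre_digraph \<Rightarrow> 't pair_pre_digraph \<Rightarrow> ('t \<Rightarrow> 'a set) \<Rightarrow> bool" where
  "path_decomposition G T B \<longleftrightarrow> path_graph T \<and> graph_decomposition G T B"

definition decomposition_width :: "'t pair_pre_digraph \<Rightarrow> ('t \<Rightarrow> 'a set) \<Rightarrow> nat" where
  "decomposition_width T B = Max ((\<lambda>t. card (B t)) ` pverts T) - 1"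

text \<open>
  Every finite tree is isomorphic to one on natural numbers, so these may serve as index
  trees.  Because of truncated subtraction the null graph gets width 0 rather than
  \<open>-1\<close>; this does not affect bounds by a natural number.
\<close>

definition treewidth :: "'a pair_pre_digraph \<Rightarrow> nat" where
  "treewidth G = (LEAST w. \<exists>(T :: nat pair_pre_digraph) B.
     tree_decomposition G T B \<and> decomposition_width T B = w)"

definition pathwidth :: "'a pair_pre_digraph \<Rightarrow> nat" where
  "pathwidth G = (LEAST w. \<exists>(T :: nat pair_pre_digraph) B.
     path_decomposition G T B \<and> decomposition_width T B = w)"

subsection \<open>Compressing partitions\<close>

text \<open>The distance is \<open>\<infinity>\<close> between vertices in different components.\<close>

definition graph_dist :: "'a pair_pre_digraph \<Rightarrow> 'a \<Rightarrow> 'a \<Rightarrow> ereal" where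
  "graph_dist G u v = wf_digraph.\<mu> (with_proj G) (\<lambda>_. 1) u v"

definition set_graph_dist :: "'a pair_pre_digraph \<Rightarrow> 'a set \<Rightarrow> 'a set \<Rightarrow> ereal" where
  "set_graph_dist G S S' = (INF u\<in>S. INF v\<in>S'. graph_dist G u v)"

text \<open>Empty sets have weak diameter \<open>-\<infinity>\<close> and distance \<open>\<infinity>\<close> to every set.\<close>

definition weak_diameter :: "'a pair_pre_digraph \<Rightarrow> 'a set \<Rightarrow> ereal" where
  "weak_diameter G S = (SUP u\<in>S. SUP v\<in>S. graph_dist G u v)"

definition indexed_partition ::
  "'b pair_pre_digraph \<Rightarrow> 'a pair_pre_digraph \<Rightarrow> ('b \<Rightarrow> 'a set) \<Rightarrow> bool" where
  "indexed_partition A G P \<longleftrightarrow>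
     disjoint_family_on P (pverts A) \<and> (\<Union>a\<in>pverts A. P a) = pverts G"

definition compressing ::
  "real \<Rightarrow> 'b pair_pre_digraph \<Rightarrow> 'a pair_pre_digraph \<Rightarrow> ('b \<Rightarrow> 'a set) \<Rightarrow> bool" where
  "compressing l A G P \<longleftrightarrow>
     (\<forall>a\<in>pverts A. \<forall>a'\<in>pverts A. a \<noteq> a' \<longrightarrow>
        set_graph_dist G (P a) (P a') \<le> ereal l \<longrightarrow> (a, a') \<in> parcs A)"

text \<open>
  A function on the nonnegative reals is a function on \<^typ>\<open>real\<close> whose values at negative
  arguments are irrelevant.  The graphs of the class share one vertex type; this is no
  restriction for classes closed under isomorphism and induced subgraphs, since the indices
  with nonempty part can be renamed injectively to vertices of \<open>H\<close>.
\<close>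

definition compressing_function ::
  "(real \<Rightarrow> real) \<Rightarrow> 'a pair_pre_digraph set \<Rightarrow> bool" where
  "compressing_function f \<H> \<longleftrightarrow>
     (\<forall>l\<ge>0. 0 \<le> f l) \<and>
     (\<forall>l\<ge>0. \<forall>H\<in>\<H>. \<exists>A\<in>\<H>. \<exists>P.
        indexed_partition A H P \<and> compressing l A H P \<and>
        (\<forall>a\<in>pverts A. weak_diameter H (P a) \<le> ereal (f l)))"

end

theory Submission
  imports Defs
begin

text \<open>
  Write \<open>L\<close> for the integer part of \<open>\<ell>\<close>.  The vertices of the graph receive numbered labels one
  at a time, so that every label class is connected and consists of vertices within a recorded
  radius of a common centre.  For a component \<open>C\<close> of the unlabelled part, all labels seen by
  \<open>C\<close> (those on its neighbours) meet a common bag that also meets \<open>C\<close>; hence \<open>C\<close> sees at most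
  \<open>k\<close> labels, and a bag that meets \<open>C\<close> and all labels seen may contain the next centre.  The gate
  of the trace of \<open>C\<close> in the index tree preserves this property, because the traces of the labels
  seen are subtrees.

  A label adjacent to \<open>C\<close> may grow into \<open>C\<close> as long as its radius plus \<open>L\<close> times the number of older
  labels seen by \<open>C\<close> stays below \<open>k L\<close>; a new centre is chosen only when no label can grow.
  When a label is cut off from \<open>C\<close>, every younger label that \<open>C\<close> sees gains \<open>L\<close> units of growth.
  Labels grow in the order of increasing load, so these units suffice to fill the part of
  \<open>C\<close> within distance \<open>L\<close> of the lost label, where it is not blocked by an older one.

  A label class has weak diameter at most \<open>2 k L\<close>, and the images of the bags form a decomposition
  of the graph of labels over the same index tree, which treats treewidth and pathwidth alike.
  Finally each vertex \<open>u\<close> moves to the oldest label among the vertices of the ball of radius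
  \<open>L div 2\<close> around \<open>u\<close> that are labelled in the first phase reaching that ball.  This adds at
  most \<open>L\<close> to the diameter, and vertices at distance at most \<open>L\<close> obtain labels with a common bag.
\<close>

subsection \<open>Connected sets, components and gates\<close>

text \<open>The empty set counts as connected, so that a condition may range over all labels,
  including those without vertices.\<close>

definition conn :: "('a \<times> 'a) set \<Rightarrow> 'a set \<Rightarrow> bool" where
  "conn R X \<longleftrightarrow> (\<forall>x\<in>X. \<forall>y\<in>X. (x, y) \<in> (R \<inter> X \<times> X)\<^sup>*)"

text \<open>
  The Helly-type property through which trees and paths enter: each \<open>t\<close> has a gate in every
  connected set.
\<close>

definition gated :: "'t set \<Rightarrow> ('t \<times> 't) set \<Rightarrow> bool" where
  "gated N F \<longleftrightarrow> (\<forall>S t. S \<subseteq> N \<longrightarrow> S \<noteq> {} \<longrightarrow> conn F S \<longrightarrow> t \<in> N \<longrightarrow>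
     (\<exists>g\<in>S. \<forall>C. C \<subseteq> N \<longrightarrow> conn F C \<longrightarrow> t \<in> C \<longrightarrow> C \<inter> S \<noteq> {} \<longrightarrow> g \<in> C))"

text \<open>For \<open>x\<close> outside \<open>U\<close> this is \<open>{x}\<close>.\<close>

definition component :: "('a \<times> 'a) set \<Rightarrow> 'a set \<Rightarrow> 'a \<Rightarrow> 'a set" where
  "component R U x = {z. (x, z) \<in> (R \<inter> U \<times> U)\<^sup>*}"

text \<open>Distance at most \<open>n\<close>, expressed by powers of the relation so that walks of
  known length can be cut and joined.\<close>

definition near :: "('a \<times> 'a) set \<Rightarrow> nat \<Rightarrow> 'a \<Rightarrow> 'a \<Rightarrow> bool" where
  "near R n x y \<longleftrightarrow> (\<exists>m\<le>n. (x, y) \<in> R ^^ m)"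

lemma nearI: "(x, y) \<in> R ^^ n \<Longrightarrow> near R n x y"
  unfolding near_def by blast

lemma near_refl: "near R n x x"
  unfolding near_def by (rule exI[of _ 0]) auto

lemma near_trans: "near R m x y \<Longrightarrow> near R n y z \<Longrightarrow> near R (m + n) x z"
  unfolding near_def by (metis add_mono relcompI relpow_add)

lemma near_mono: "near R m x y \<Longrightarrow> m \<le> n \<Longrightarrow> near R n x y"
  unfolding near_def by (meson order_trans)

lemma near_step: "(x, y) \<in> R \<Longrightarrow> near R 1 x y"
  unfolding near_def by (rule exI[of _ 1]) auto

lemma near_sym:
  assumes "sym R" "near R n x y"
  shows "near R n y x"
proof -
  have "(x, y) \<in> R ^^ m \<Longrightarrow> (y, x) \<in> R ^^ m" for m x y
  proof (induction m arbitrary: y)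
    case (Suc m)
    then obtain z where z: "(x, z) \<in> R ^^ m" "(z, y) \<in> R" by auto
    then have "(y, z) \<in> R" using assms(1) by (auto dest: symD)
    then show ?case using Suc.IH[OF z(1)] by (rule relpow_Suc_I2)
  qed auto
  then show ?thesis using assms(2) unfolding near_def by blast
qed

lemma sym_restrict: "sym R \<Longrightarrow> sym (R \<inter> X \<times> X)"
  by (auto simp: sym_def)

lemma conn_rtrancl_mono: "(x, y) \<in> (R \<inter> X \<times> X)\<^sup>* \<Longrightarrow> X \<subseteq> Y \<Longrightarrow> (x, y) \<in> (R \<inter> Y \<times> Y)\<^sup>*"
  by (erule rtrancl_mono[THEN subsetD, rotated]) auto

lemma conn_Un:
  assumes "conn R X" "conn R Y" "z \<in> X" "z \<in> Y"
  shows "conn R (X \<union> Y)"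
proof -
  have "(x, z) \<in> (R \<inter> (X \<union> Y) \<times> (X \<union> Y))\<^sup>* \<and> (z, x) \<in> (R \<inter> (X \<union> Y) \<times> (X \<union> Y))\<^sup>*"
    if "x \<in> X \<union> Y" for x
    using that assms conn_rtrancl_mono[of _ _ R X "X \<union> Y"] conn_rtrancl_mono[of _ _ R Y "X \<union> Y"]
    unfolding conn_def by (metis Un_iff sup_ge1 sup_ge2)
  then show ?thesis unfolding conn_def by (meson rtrancl_trans)
qed

lemma conn_insert:
  assumes "conn R X" "sym R" "q \<in> X" "(q, p) \<in> R"
  shows "conn R (insert p X)"
proof -
  have "(p, q) \<in> R" using assms by (auto dest: symD)
  then have "conn R {q, p}"
    using assms(4) unfolding conn_def by auto
  from conn_Un[OF assms(1) this assms(3)] show ?thesis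
    using assms(3) by (simp add: insert_absorb Un_commute)
qed

lemma conn_component: "sym R \<Longrightarrow> x \<in> U \<Longrightarrow> conn R (component R U x)"
proof -
  assume s: "sym R" "x \<in> U"
  let ?C = "component R U x"
  have "(x, z) \<in> (R \<inter> U \<times> U)\<^sup>* \<Longrightarrow> (x, z) \<in> (R \<inter> ?C \<times> ?C)\<^sup>*" for z
  proof (induction rule: rtrancl_induct)
    case (step y z)
    then have "y \<in> ?C" "z \<in> ?C" by (auto simp: component_def intro: rtrancl_into_rtrancl)
    then show ?case using step by (meson IntI IntD1 SigmaI rtrancl.rtrancl_into_rtrancl)
  qed auto
  then have a: "z \<in> ?C \<Longrightarrow> (x, z) \<in> (R \<inter> ?C \<times> ?C)\<^sup>*" for z by (simp add: component_def)
  moreover have "z \<in> ?C \<Longrightarrow> (z, x) \<in> (R \<inter> ?C \<times> ?C)\<^sup>*" for z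
    using a sym_rtrancl[OF sym_restrict[OF s(1)]] by (meson symD)
  ultimately show ?thesis unfolding conn_def by (meson rtrancl_trans)
qed

lemma component_refl: "x \<in> component R U x"
  by (simp add: component_def)

lemma component_subset: "x \<in> U \<Longrightarrow> component R U x \<subseteq> U"
  by (auto simp: component_def elim: rtranclE)

lemma component_mono: "U' \<subseteq> U \<Longrightarrow> component R U' x \<subseteq> component R U x"
  by (auto simp: component_def intro: conn_rtrancl_mono)

lemma component_eq:
  assumes "sym R" "z \<in> component R U x"
  shows "component R U z = component R U x"
proof -
  have "(x, z) \<in> (R \<inter> U \<times> U)\<^sup>*" using assms by (simp add: component_def)
  moreover from this have "(z, x) \<in> (R \<inter> U \<times> U)\<^sup>*"
    using sym_rtrancl[OF sym_restrict[OF assms(1)]] by (meson symD)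
  ultimately show ?thesis unfolding component_def by (auto intro: rtrancl_trans)
qed

lemma component_step:
  "z \<in> component R U x \<Longrightarrow> z \<in> U \<Longrightarrow> (z, z') \<in> R \<Longrightarrow> z' \<in> U \<Longrightarrow> z' \<in> component R U x"
  by (auto simp: component_def intro: rtrancl_into_rtrancl)

lemma component_remove:
  assumes "p \<notin> component R U x"
  shows "component R (U - {p}) x = component R U x"
proof
  show "component R (U - {p}) x \<subseteq> component R U x" by (rule component_mono) auto
  have "(x, z) \<in> (R \<inter> (U - {p}) \<times> (U - {p}))\<^sup>*" if "(x, z) \<in> (R \<inter> U \<times> U)\<^sup>*" for z
    using that
  proof (induction rule: rtrancl_induct)
    case (step y z)
    then have "y \<in> component R U x" "z \<in> component R U x"
      by (auto simp: component_def intro: rtrancl_into_rtrancl)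
    then have "y \<noteq> p" "z \<noteq> p" using assms by auto
    then show ?case using step by (auto intro: rtrancl_into_rtrancl)
  qed auto
  then show "component R U x \<subseteq> component R (U - {p}) x" by (auto simp: component_def)
qed

text \<open>Cut the walk at \<open>q\<close>, its last vertex outside \<open>K\<close>;
  \<open>j\<close> is the length of what remains. The relation
  \<open>R \<inter> UNIV \<times> Z\<close> constrains only the targets of steps, so the start
  \<open>w\<close> may lie outside \<open>Z\<close>.\<close>

lemma walk_last_exit:
  assumes "(w, x) \<in> (R \<inter> UNIV \<times> Z) ^^ i" "x \<in> K" "w \<notin> K"
  shows "\<exists>q j. 0 < j \<and> j \<le> i \<and> (j < i \<or> q = w) \<and> q \<notin> K \<and> q \<in> insert w Z \<and>
    (\<exists>z\<in>K. (q, z) \<in> R) \<and> (q, x) \<in> (R \<inter> UNIV \<times> K) ^^ j"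
  using assms
proof (induction i arbitrary: x)
  case (Suc i)
  then obtain z where z: "(w, z) \<in> (R \<inter> UNIV \<times> Z) ^^ i" "(z, x) \<in> R" "x \<in> Z" by auto
  show ?case
  proof (cases "z \<in> K")
    case True
    from Suc.IH[OF z(1) this Suc.prems(3)] obtain q j where
      "0 < j \<and> j \<le> i \<and> (j < i \<or> q = w) \<and> q \<notin> K \<and> q \<in> insert w Z \<and>
       (\<exists>z\<in>K. (q, z) \<in> R) \<and> (q, z) \<in> (R \<inter> UNIV \<times> K) ^^ j" by blast
    then show ?thesis using z Suc.prems
      by (intro exI[of _ q] exI[of _ "Suc j"]) auto
  next
    case False
    have "z = w \<and> i = 0 \<or> z \<in> Z \<and> 0 < i" using z(1) by (cases i) auto
    then show ?thesis using False z Suc.prems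
      by (intro exI[of _ z] exI[of _ 1]) auto
  qed
qed auto

subsection \<open>Growing labels\<close>

text \<open>The index graph enters only through its gates, so index trees and index paths are
  instances of the same argument.\<close>

locale decomposed_graph =
  fixes V :: "'a set" and E :: "('a \<times> 'a) set"
    and N :: "'t set" and F :: "('t \<times> 't) set" and B :: "'t \<Rightarrow> 'a set"
    and k L :: nat
  assumes finite_V: "finite V"
    and E_subset: "E \<subseteq> V \<times> V"
    and sym_E: "sym E"
    and gated_tree: "gated N F"
    and bag_subset: "t \<in> N \<Longrightarrow> B t \<subseteq> V"
    and bag_card: "t \<in> N \<Longrightarrow> card (B t) \<le> Suc k"
    and edge_bag: "(u, v) \<in> E \<Longrightarrow> \<exists>t\<in>N. u \<in> B t \<and> v \<in> B t"
    and vertex_bag: "v \<in> V \<Longrightarrow> \<exists>t\<in>N. v \<in> B t"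
    and conn_bags: "v \<in> V \<Longrightarrow> conn F {t \<in> N. v \<in> B t}"
begin

text \<open>
  A state consists of the set \<open>U\<close> of unlabelled vertices, the labelling \<open>\<psi>\<close> and the radii \<open>b\<close>; the
  values of \<open>\<psi>\<close> and \<open>b\<close> on \<open>U\<close> carry no meaning.  Smaller labels are older.
\<close>

abbreviation comp :: "'a set \<Rightarrow> 'a \<Rightarrow> 'a set" where
  "comp \<equiv> component E"

definition rim :: "'a set \<Rightarrow> 'a \<Rightarrow> 'a set" where
  "rim U x = {q \<in> V - U. \<exists>z\<in>comp U x. (q, z) \<in> E}"

definition seen :: "'a set \<Rightarrow> ('a \<Rightarrow> nat) \<Rightarrow> 'a \<Rightarrow> nat set" where
  "seen U \<psi> x = \<psi> ` rim U x"

text \<open>The second summand reserves \<open>L\<close> units of growth for every older label that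
  the component may still lose; losing one releases its share.\<close>

definition load :: "'a set \<Rightarrow> ('a \<Rightarrow> nat) \<Rightarrow> ('a \<Rightarrow> nat) \<Rightarrow> 'a \<Rightarrow> 'a \<Rightarrow> nat" where
  "load U \<psi> b x q = b q + card {m \<in> seen U \<psi> x. m < \<psi> q} * L"

definition saturated :: "'a set \<Rightarrow> ('a \<Rightarrow> nat) \<Rightarrow> ('a \<Rightarrow> nat) \<Rightarrow> bool" where
  "saturated U \<psi> b \<longleftrightarrow> (\<forall>x\<in>U. \<forall>q\<in>rim U x. k * L \<le> load U \<psi> b x q)"

text \<open>The bag need not meet the component of \<open>x\<close> here: \<open>valid\<close> asks
  for that separately, while \<open>create_at\<close> asks for a bag through the new centre.\<close>

definition hub :: "'a set \<Rightarrow> ('a \<Rightarrow> nat) \<Rightarrow> 'a \<Rightarrow> 't \<Rightarrow> bool" where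
  "hub U \<psi> x t \<longleftrightarrow> t \<in> N \<and> (\<forall>n\<in>seen U \<psi> x. \<exists>v\<in>B t - U. \<psi> v = n)"

text \<open>Centres are not recorded. The condition \<open>near E (b p + b q) p q\<close> is what
  two walks of lengths \<open>b p\<close> and \<open>b q\<close> to a common centre would give, and
  it is all that the diameter bound uses.\<close>

definition valid :: "'a set \<Rightarrow> ('a \<Rightarrow> nat) \<Rightarrow> ('a \<Rightarrow> nat) \<Rightarrow> bool" where
  "valid U \<psi> b \<longleftrightarrow> U \<subseteq> V \<and>
     (\<forall>n. conn E {v \<in> V - U. \<psi> v = n}) \<and>
     (\<forall>x\<in>U. \<exists>t. hub U \<psi> x t \<and> B t \<inter> comp U x \<noteq> {}) \<and>
     (\<forall>x\<in>U. \<forall>q\<in>rim U x. load U \<psi> b x q \<le> k * L) \<and>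
     (\<forall>p\<in>V - U. \<forall>q\<in>V - U. \<psi> p = \<psi> q \<longrightarrow> near E (b p + b q) p q) \<and>
     (\<forall>p\<in>V - U. b p \<le> k * L)"

text \<open>Growth in the order of increasing load ensures that a label with room to reach a vertex
  still has room, or has passed it on, after another label has grown.\<close>

definition absorb_at :: "'a set \<Rightarrow> ('a \<Rightarrow> nat) \<Rightarrow> ('a \<Rightarrow> nat) \<Rightarrow> 'a \<Rightarrow> 'a \<Rightarrow> bool" where
  "absorb_at U \<psi> b p q \<longleftrightarrow> p \<in> U \<and> q \<in> rim U p \<and> (q, p) \<in> E \<and> load U \<psi> b p q < k * L \<and>
     (\<forall>r\<in>rim U p. load U \<psi> b p q \<le> load U \<psi> b p r)"

text \<open>The bound on \<open>c\<close> also covers the meaningless values of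
  \<open>\<psi>\<close> on \<open>U\<close>; it makes \<open>c\<close> fresh and younger than every
  label in use.\<close>

definition create_at :: "'a set \<Rightarrow> ('a \<Rightarrow> nat) \<Rightarrow> ('a \<Rightarrow> nat) \<Rightarrow> 'a \<Rightarrow> nat \<Rightarrow> bool" where
  "create_at U \<psi> b p c \<longleftrightarrow> p \<in> U \<and> saturated U \<psi> b \<and> (\<forall>v\<in>V. \<psi> v < c) \<and>
     (\<exists>t. hub U \<psi> p t \<and> p \<in> B t)"

text \<open>Both moves give \<open>p\<close> a label \<open>c\<close> and a radius
  \<open>\<beta>\<close>, so that their common consequences can be proved once.\<close>

definition step :: "'a set \<Rightarrow> ('a \<Rightarrow> nat) \<Rightarrow> ('a \<Rightarrow> nat) \<Rightarrow> 'a \<Rightarrow> nat \<Rightarrow> nat \<Rightarrow> bool" where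
  "step U \<psi> b p c \<beta> \<longleftrightarrow>
     (\<exists>q. absorb_at U \<psi> b p q \<and> c = \<psi> q \<and> \<beta> = b q + 1) \<or> create_at U \<psi> b p c \<and> \<beta> = 0"

section \<open>Rims, seen labels and loads when one vertex is labelled\<close>

lemma symE: "(x, y) \<in> E \<Longrightarrow> (y, x) \<in> E"
  using sym_E by (rule symD)

lemma finite_rim: "finite (rim U x)"
  unfolding rim_def using finite_V by auto

lemma finite_seen: "finite (seen U \<psi> x)"
  unfolding seen_def using finite_rim by auto

lemma step_in: "step U \<psi> b p c \<beta> \<Longrightarrow> p \<in> U"
  by (auto simp: step_def absorb_at_def create_at_def)

lemma rim_cong: "z \<in> comp U x \<Longrightarrow> rim U z = rim U x"
  by (simp add: rim_def component_eq[OF sym_E])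

lemma seen_cong: "z \<in> comp U x \<Longrightarrow> seen U \<psi> z = seen U \<psi> x"
  by (simp add: seen_def rim_cong)

lemma load_cong: "z \<in> comp U x \<Longrightarrow> load U \<psi> b z q = load U \<psi> b x q"
  by (simp add: load_def seen_cong)

lemma rim_remove:
  assumes "x \<in> U" "x \<noteq> p"
  shows "rim (U - {p}) x \<subseteq> insert p (rim U x)"
  using component_mono[of "U - {p}" U E x] unfolding rim_def by auto

lemma in_rim_remove:
  assumes "x \<in> U" "x \<noteq> p" "p \<in> U" "p \<in> rim (U - {p}) x"
  shows "p \<in> comp U x"
proof -
  obtain z where z: "z \<in> comp (U - {p}) x" "(p, z) \<in> E" using assms by (auto simp: rim_def)
  then have "z \<in> comp U x" using component_mono[of "U - {p}" U E x] by auto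
  then show ?thesis using z(2) assms component_subset[of x U E]
    by (meson component_step symE subsetD)
qed

lemma comp_rim_remove_other:
  assumes "x \<in> U" "p \<in> U" "p \<notin> comp U x"
  shows "comp (U - {p}) x = comp U x" "rim (U - {p}) x = rim U x"
proof -
  show c: "comp (U - {p}) x = comp U x" by (rule component_remove[OF assms(3)])
  have "x \<noteq> p" using assms component_refl by metis
  then have "p \<notin> rim (U - {p}) x" using in_rim_remove assms by metis
  then show "rim (U - {p}) x = rim U x" using c by (auto simp: rim_def)
qed

lemma seen_load_remove_other:
  assumes "x \<in> U" "p \<in> U" "p \<notin> comp U x"
  shows "seen (U - {p}) (\<psi>(p := c)) x = seen U \<psi> x"
    and "q \<in> rim U x \<Longrightarrow> load (U - {p}) (\<psi>(p := c)) (b(p := \<beta>)) x q = load U \<psi> b x q"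
proof -
  have p: "p \<notin> rim U x" using assms by (simp add: rim_def)
  then show s: "seen (U - {p}) (\<psi>(p := c)) x = seen U \<psi> x"
    by (auto simp: seen_def comp_rim_remove_other[OF assms])
  show "q \<in> rim U x \<Longrightarrow> load (U - {p}) (\<psi>(p := c)) (b(p := \<beta>)) x q = load U \<psi> b x q"
    using p by (auto simp: load_def s)
qed

text \<open>A hub bag that meets the component contains an unlabelled vertex, which leaves at most
  \<open>k\<close> of its \<open>k + 1\<close> places for representatives of the seen
  labels.\<close>

lemma card_seen:
  assumes "valid U \<psi> b" "x \<in> U"
  shows "card (seen U \<psi> x) \<le> k"
proof -
  obtain t y where t: "hub U \<psi> x t" "y \<in> B t" "y \<in> comp U x"
    using assms unfolding valid_def by blast
  have tN: "t \<in> N" using t by (simp add: hub_def)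
  have fin: "finite (B t)" using bag_subset[OF tN] finite_V finite_subset by blast
  have "y \<in> U" using t component_subset[OF assms(2)] by auto
  then have "B t - U \<subset> B t" using t by auto
  then have "card (B t - U) < card (B t)" using fin by (rule psubset_card_mono[rotated])
  moreover have "seen U \<psi> x \<subseteq> \<psi> ` (B t - U)" using t(1) unfolding hub_def by (force simp: image_iff)
  then have "card (seen U \<psi> x) \<le> card (B t - U)"
    using fin by (meson card_image_le card_mono finite_Diff finite_imageI order_trans)
  ultimately show ?thesis using bag_card[OF tN] by linarith
qed

lemma step_seen:
  assumes "step U \<psi> b p c \<beta>" "x \<in> U" "x \<noteq> p"
  shows "seen (U - {p}) (\<psi>(p := c)) x \<subseteq> insert c (seen U \<psi> x)"
proof -
  have "p \<notin> rim U x" using step_in[OF assms(1)] by (simp add: rim_def)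
  then show ?thesis using rim_remove[OF assms(2,3)] by (auto simp: seen_def)
qed

text \<open>If \<open>p\<close> lies in the component of \<open>x\<close>, the label it receives was
  already on the common rim; otherwise nothing changes for \<open>x\<close>.\<close>

lemma absorb_seen:
  assumes "absorb_at U \<psi> b p q" "x \<in> U" "x \<noteq> p"
  shows "seen (U - {p}) (\<psi>(p := \<psi> q)) x \<subseteq> seen U \<psi> x"
proof -
  have pU: "p \<in> U" "q \<in> rim U p" using assms(1) by (auto simp: absorb_at_def)
  show ?thesis
  proof (cases "p \<in> comp U x")
    case True
    have "\<psi> q \<in> seen U \<psi> x" using pU seen_cong[OF True] by (auto simp: seen_def)
    moreover have "step U \<psi> b p (\<psi> q) (b q + 1)" using assms(1) by (auto simp: step_def)
    ultimately show ?thesis using step_seen assms(2,3) by fastforce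
  next
    case False
    then show ?thesis using seen_load_remove_other(1)[OF assms(2) pU(1)] by simp
  qed
qed

text \<open>A newly created label is the youngest, so it never counts among the older ones; an
  absorption brings no new label into view.\<close>

lemma step_lower:
  assumes "valid U \<psi> b" "step U \<psi> b p c \<beta>" "x \<in> U" "x \<noteq> p" "r \<in> rim (U - {p}) x"
  shows "{m \<in> seen (U - {p}) (\<psi>(p := c)) x. m < (\<psi>(p := c)) r} \<subseteq>
    {m \<in> seen U \<psi> x. m < (\<psi>(p := c)) r}"
  using assms(2)[unfolded step_def]
proof (elim disjE exE conjE)
  fix q assume "absorb_at U \<psi> b p q" "c = \<psi> q"
  then show ?thesis using absorb_seen assms(3,4) by blast
next
  assume "create_at U \<psi> b p c"
  then have "(\<psi>(p := c)) r \<le> c" using assms(5) by (auto simp: create_at_def rim_def less_imp_le)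
  then show ?thesis using step_seen[OF assms(2-4)] by fastforce
qed

text \<open>All four bounds compare the older labels seen after the step with those seen before it.
  The last one expresses the release of \<open>L\<close> units when an older label is lost.\<close>

lemma step_load:
  assumes "valid U \<psi> b" "step U \<psi> b p c \<beta>" "x \<in> U" "x \<noteq> p" "r \<in> rim (U - {p}) x"
  defines "l \<equiv> load (U - {p}) (\<psi>(p := c)) (b(p := \<beta>)) x r"
  shows "l \<le> k * L"
    and "r \<noteq> p \<Longrightarrow> l \<le> load U \<psi> b x r"
    and "absorb_at U \<psi> b p q \<Longrightarrow> c = \<psi> q \<Longrightarrow> \<beta> = b q + 1 \<Longrightarrow> r = p \<Longrightarrow> l \<le> load U \<psi> b x q + 1"
    and "m \<in> seen U \<psi> x \<Longrightarrow> m < (\<psi>(p := c)) r \<Longrightarrow> m \<notin> seen (U - {p}) (\<psi>(p := c)) x \<Longrightarrow>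
      l + L \<le> k * L"
proof -
  let ?s = "(\<psi>(p := c)) r"
  let ?A' = "{m \<in> seen (U - {p}) (\<psi>(p := c)) x. m < ?s}" and ?A = "{m \<in> seen U \<psi> x. m < ?s}"
  have sub: "?A' \<subseteq> ?A" by (rule step_lower[OF assms(1-5)])
  have fin: "finite ?A" using finite_seen by auto
  have le: "card ?A' * L \<le> card ?A * L" using card_mono[OF fin sub] by simp
  have strict: "card ?A' * L + L \<le> card ?A * L"
    if "m \<in> seen U \<psi> x" "m < ?s" "m \<notin> seen (U - {p}) (\<psi>(p := c)) x" for m
  proof -
    have "?A' \<subset> ?A" using sub that by blast
    then have "Suc (card ?A') \<le> card ?A" using fin by (simp add: psubset_card_mono Suc_leI)
    then have "Suc (card ?A') * L \<le> card ?A * L" by (rule mult_le_mono1)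
    then show ?thesis by simp
  qed
  have l: "l = (if r = p then \<beta> else b r) + card ?A' * L" by (simp add: l_def load_def)
  have pU: "p \<in> U" by (rule step_in[OF assms(2)])
  have ld: "load U \<psi> b x r = b r + card ?A * L" "load U \<psi> b x r \<le> k * L" if "r \<noteq> p"
  proof -
    have "r \<in> rim U x" using that assms(5) rim_remove[OF assms(3,4)] by auto
    then show "load U \<psi> b x r \<le> k * L" using assms(1,3) by (simp add: valid_def)
    show "load U \<psi> b x r = b r + card ?A * L" using that by (simp add: load_def)
  qed
  show "r \<noteq> p \<Longrightarrow> l \<le> load U \<psi> b x r" using ld l le by simp
  have pc: "p \<in> comp U x" if "r = p" using in_rim_remove[OF assms(3,4) pU] assms(5) that by simp
  have ab: "b q + 1 + card ?A * L = load U \<psi> b x q + 1" "load U \<psi> b x q + 1 \<le> k * L"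
    if "absorb_at U \<psi> b p q" "c = \<psi> q" "r = p" for q
  proof -
    show "b q + 1 + card ?A * L = load U \<psi> b x q + 1" using that by (simp add: load_def)
    show "load U \<psi> b x q + 1 \<le> k * L"
      using that load_cong[OF pc[OF that(3)]] by (simp add: absorb_at_def)
  qed
  show "absorb_at U \<psi> b p q \<Longrightarrow> c = \<psi> q \<Longrightarrow> \<beta> = b q + 1 \<Longrightarrow> r = p \<Longrightarrow> l \<le> load U \<psi> b x q + 1"
  proof -
    assume a: "absorb_at U \<psi> b p q" "c = \<psi> q" "\<beta> = b q + 1" "r = p"
    have "l = b q + 1 + card ?A' * L" using l a(3,4) by simp
    then show "l \<le> load U \<psi> b x q + 1" using le ab(1)[OF a(1,2,4)] by linarith
  qed
  \<comment> \<open>This settles a new centre: its radius is 0 and it has at most \<open>k\<close>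
    older labels above it.\<close>
  have cr: "card ?A * L \<le> k * L"
  proof -
    have "card ?A \<le> card (seen U \<psi> x)" by (rule card_mono[OF finite_seen]) auto
    then have "card ?A \<le> k" using card_seen[OF assms(1,3)] by linarith
    then show ?thesis by (rule mult_le_mono1)
  qed
  have new: "(\<exists>q. absorb_at U \<psi> b p q \<and> c = \<psi> q \<and> \<beta> = b q + 1) \<or> \<beta> = 0"
    using assms(2) by (auto simp: step_def)
  \<comment> \<open>The new radius is combined with the old count of older labels; a lost label then
    saves a full \<open>L\<close> below the bound.\<close>
  have base: "(if r = p then \<beta> else b r) + card ?A * L \<le> k * L"
  proof (cases "r = p")
    case True
    show ?thesis
    proof (cases "\<beta> = 0")
      case False
      then obtain q where "absorb_at U \<psi> b p q" "c = \<psi> q" "\<beta> = b q + 1" using new by auto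
      then show ?thesis using ab[of q] True by simp
    qed (use cr True in simp)
  qed (use ld in simp)
  then show "l \<le> k * L" using l le by linarith
  show "m \<in> seen U \<psi> x \<Longrightarrow> m < (\<psi>(p := c)) r \<Longrightarrow> m \<notin> seen (U - {p}) (\<psi>(p := c)) x \<Longrightarrow>
      l + L \<le> k * L"
    using base strict[of m] unfolding l by linarith
qed

section \<open>Preservation of the invariants by a step\<close>

text \<open>The bags containing one vertex form a connected set, and the sets of two adjacent
  vertices overlap in a bag that contains the edge.\<close>

lemma conn_bags_Union:
  assumes "X \<subseteq> V" "conn E X"
  shows "conn F {t \<in> N. B t \<inter> X \<noteq> {}}"
proof -
  let ?S = "{t \<in> N. B t \<inter> X \<noteq> {}}"
  have bags: "(s, t) \<in> (F \<inter> ?S \<times> ?S)\<^sup>*"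
    if "s \<in> N" "t \<in> N" "v \<in> B s" "v \<in> B t" "v \<in> X" for s t v
  proof -
    have "(s, t) \<in> (F \<inter> {t \<in> N. v \<in> B t} \<times> {t \<in> N. v \<in> B t})\<^sup>*"
      using conn_bags[of v] that assms(1) unfolding conn_def by blast
    then show ?thesis by (rule conn_rtrancl_mono) (use that in auto)
  qed
  have "(s, t) \<in> (F \<inter> ?S \<times> ?S)\<^sup>*"
    if "(x, y) \<in> (E \<inter> X \<times> X)\<^sup>*" "s \<in> N" "x \<in> B s" "x \<in> X" "t \<in> N" "y \<in> B t" for s t x y
    using that
  proof (induction arbitrary: t rule: rtrancl_induct)
    case (step y z)
    then obtain r where r: "r \<in> N" "y \<in> B r" "z \<in> B r" using edge_bag by blast
    have "(s, r) \<in> (F \<inter> ?S \<times> ?S)\<^sup>*" using step r by blast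
    moreover have "(r, t) \<in> (F \<inter> ?S \<times> ?S)\<^sup>*" using bags[of r t z] step r by blast
    ultimately show ?case by (rule rtrancl_trans)
  qed (use bags in blast)
  then show ?thesis using assms(2) unfolding conn_def by blast
qed

lemma exit_rim:
  assumes "x \<in> U" "q \<notin> comp U x" "z \<in> comp U x" "(q, z) \<in> E"
  shows "q \<in> rim U x"
proof -
  have "q \<notin> U" using assms component_step[of z E U x q] component_subset[of x U E] symE by blast
  then show ?thesis using assms E_subset by (auto simp: rim_def)
qed

lemma step_class:
  assumes "valid U \<psi> b" "step U \<psi> b p c \<beta>"
  shows "conn E {v \<in> V - (U - {p}). (\<psi>(p := c)) v = n}"
proof -
  have p: "p \<in> U" "p \<in> V" using step_in[OF assms(2)] assms(1) by (auto simp: valid_def)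
  have old: "conn E {v \<in> V - U. \<psi> v = m}" for m using assms(1) by (simp add: valid_def)
  show ?thesis
  proof (cases "n = c")
    case False
    then have "{v \<in> V - (U - {p}). (\<psi>(p := c)) v = n} = {v \<in> V - U. \<psi> v = n}" using p by auto
    then show ?thesis using old by simp
  next
    case True
    then have eq: "{v \<in> V - (U - {p}). (\<psi>(p := c)) v = n} = insert p {v \<in> V - U. \<psi> v = c}"
      using p by auto
    from assms(2)[unfolded step_def] show ?thesis
    proof (elim disjE exE conjE)
      fix q assume "absorb_at U \<psi> b p q" "c = \<psi> q"
      then have "q \<in> {v \<in> V - U. \<psi> v = c}" "(q, p) \<in> E" by (auto simp: absorb_at_def rim_def)
      then show ?thesis unfolding eq by (intro conn_insert[OF old sym_E])
    next
      assume "create_at U \<psi> b p c"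
      then have "{v \<in> V - U. \<psi> v = c} = {}" unfolding create_at_def by force
      then have "{v \<in> V - (U - {p}). (\<psi>(p := c)) v = n} = {p}" using eq by blast
      then show ?thesis by (simp only:) (simp add: conn_def)
    qed
  qed
qed

text \<open>A bag with all seen labels is moved to the gate of the trace of the shrunken component.
  The trace of each seen label is connected and meets that of the component, so it contains the gate
  as well.\<close>

lemma step_hub:
  assumes "valid U \<psi> b" "step U \<psi> b p c \<beta>" "x \<in> U" "x \<noteq> p"
  shows "\<exists>t. hub (U - {p}) (\<psi>(p := c)) x t \<and> B t \<inter> comp (U - {p}) x \<noteq> {}"
proof (cases "p \<in> comp U x")
  case False
  have p: "p \<in> U" by (rule step_in[OF assms(2)])
  obtain t where t: "hub U \<psi> x t" "B t \<inter> comp U x \<noteq> {}"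
    using assms(1,3) unfolding valid_def by blast
  have "\<exists>v\<in>B t - (U - {p}). (\<psi>(p := c)) v = n" if n: "n \<in> seen U \<psi> x" for n
  proof -
    obtain v where "v \<in> B t - U" "\<psi> v = n" using t(1) n unfolding hub_def by blast
    then show ?thesis using p by (intro bexI[of _ v]) auto
  qed
  then show ?thesis
    using t
      unfolding hub_def comp_rim_remove_other[OF assms(3) p False] seen_load_remove_other(1)[OF assms(3) p False]
    by blast
next
  case True
  let ?U = "U - {p}" and ?\<psi> = "\<psi>(p := c)"
  let ?M = "\<lambda>n. {v \<in> V - ?U. ?\<psi> v = n}"
  have U: "U \<subseteq> V" "p \<in> U" "x \<in> ?U" using assms step_in by (auto simp: valid_def)
  \<comment> \<open>After an absorption the old hub serves; after a creation it is the bag chosen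
    with the centre, which also hosts the new label.\<close>
  obtain t where t: "t \<in> N" and tn: "\<And>n. n \<in> seen ?U ?\<psi> x \<Longrightarrow> \<exists>v\<in>B t. v \<in> ?M n"
  proof -
    have keep: "\<exists>v\<in>B t. v \<in> ?M n" if h: "hub U \<psi> x t" "n \<in> seen U \<psi> x" for t n
    proof -
      obtain v where v: "v \<in> B t" "v \<notin> U" "\<psi> v = n" using h unfolding hub_def by blast
      then have "v \<in> ?M n" using U bag_subset[of t] h(1) unfolding hub_def by auto
      then show ?thesis using v by blast
    qed
    from assms(2)[unfolded step_def] show ?thesis
    proof (elim disjE exE conjE)
      fix q assume q: "absorb_at U \<psi> b p q" "c = \<psi> q"
      obtain t where "hub U \<psi> x t" using assms(1,3) unfolding valid_def by blast
      then show ?thesis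
        using that[of t] keep[of t] absorb_seen[OF q(1) assms(3,4)] q(2) unfolding hub_def by blast
    next
      assume "create_at U \<psi> b p c"
      then obtain t where t: "hub U \<psi> p t" "p \<in> B t" unfolding create_at_def by blast
      have h: "hub U \<psi> x t" using t(1) seen_cong[OF True] by (simp add: hub_def)
      have "p \<in> ?M c" using U by auto
      then have "\<exists>v\<in>B t. v \<in> ?M n" if "n \<in> seen ?U ?\<psi> x" for n
        using that step_seen[OF assms(2-4)] keep[OF h, of n] t(2) by blast
      then show ?thesis using that[of t] h unfolding hub_def by blast
    qed
  qed
  let ?S = "{s \<in> N. B s \<inter> comp ?U x \<noteq> {}}"
  have cV: "comp ?U x \<subseteq> V" using component_subset[OF U(3)] U(1) by blast
  have "?S \<noteq> {}" using vertex_bag[of x] assms(3) U(1) component_refl by fastforce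
  moreover have "conn F ?S" by (rule conn_bags_Union[OF cV conn_component[OF sym_E U(3)]])
  ultimately obtain g where g: "g \<in> ?S"
    and gC: "\<And>C. C \<subseteq> N \<Longrightarrow> conn F C \<Longrightarrow> t \<in> C \<Longrightarrow> C \<inter> ?S \<noteq> {} \<Longrightarrow> g \<in> C"
    using gated_tree t unfolding gated_def by (metis (no_types, lifting) mem_Collect_eq subsetI)
  have "\<exists>v\<in>B g - ?U. ?\<psi> v = n" if n: "n \<in> seen ?U ?\<psi> x" for n
  proof -
    let ?C = "{s \<in> N. B s \<inter> ?M n \<noteq> {}}"
    obtain q z where q: "q \<in> ?M n" "z \<in> comp ?U x" "(q, z) \<in> E"
      using n unfolding seen_def rim_def by blast
    \<comment> \<open>A bag containing an edge from the class to the component witnesses that the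
      two traces intersect.\<close>
    obtain s where "s \<in> N" "q \<in> B s" "z \<in> B s" using edge_bag[OF q(3)] by blast
    then have "?C \<inter> ?S \<noteq> {}" using q by blast
    moreover have "conn F ?C" by (rule conn_bags_Union) (use step_class[OF assms(1,2)] in auto)
    moreover have "t \<in> ?C" using t tn[OF n] by blast
    ultimately have "g \<in> ?C" by (intro gC) auto
    then show ?thesis by blast
  qed
  then show ?thesis using g unfolding hub_def by blast
qed

lemma step_valid:
  assumes "valid U \<psi> b" "step U \<psi> b p c \<beta>"
  shows "valid (U - {p}) (\<psi>(p := c)) (b(p := \<beta>))"
proof -
  have p: "p \<in> U" "p \<in> V" using step_in[OF assms(2)] assms(1) by (auto simp: valid_def)
  have near_old: "near E (b u + b v) u v" if "u \<in> V - U" "v \<in> V - U" "\<psi> u = \<psi> v" for u v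
    using assms(1) that by (simp add: valid_def)
  have new: "\<beta> \<le> k * L \<and> (\<forall>v\<in>V - U. \<psi> v = c \<longrightarrow> near E (\<beta> + b v) p v)"
    using assms(2)[unfolded step_def]
  proof (elim disjE exE conjE)
    fix q assume q: "absorb_at U \<psi> b p q" "c = \<psi> q" "\<beta> = b q + 1"
    have "near E (1 + (b q + b v)) p v" if "v \<in> V - U" "\<psi> v = c" for v
      using q that by (intro near_trans[OF near_step near_old])
        (auto simp: absorb_at_def rim_def intro: symE)
    moreover have "b q < k * L" using q by (auto simp: absorb_at_def load_def)
    ultimately show ?thesis using q by (auto simp: add.commute add.left_commute)
  next
    assume "create_at U \<psi> b p c" "\<beta> = 0"
    then show ?thesis unfolding create_at_def by fastforce
  qed
  have "near E ((b(p := \<beta>)) u + (b(p := \<beta>)) v) u v"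
    if "u \<in> V - (U - {p})" "v \<in> V - (U - {p})" "(\<psi>(p := c)) u = (\<psi>(p := c)) v" for u v
  proof (cases "u = p"; cases "v = p")
    assume "u = p" "v = p" then show ?thesis by (simp add: near_refl)
  next
    assume "u = p" "v \<noteq> p" then show ?thesis using that new by auto
  next
    assume "u \<noteq> p" "v = p"
    then have "near E (\<beta> + b u) p u" using that new by auto
    then show ?thesis using \<open>u \<noteq> p\<close> \<open>v = p\<close> near_sym[OF sym_E] by (simp add: add.commute)
  next
    assume "u \<noteq> p" "v \<noteq> p" then show ?thesis using that near_old by auto
  qed
  moreover have "\<forall>v\<in>V - (U - {p}). (b(p := \<beta>)) v \<le> k * L"
    using new assms(1) by (auto simp: valid_def)
  moreover have "U - {p} \<subseteq> V" using assms(1) by (auto simp: valid_def)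
  ultimately show ?thesis
    unfolding valid_def using step_class[OF assms] step_hub[OF assms] step_load(1)[OF assms] by auto
qed

section \<open>Guarded labels\<close>

text \<open>
  Once this holds, the component of \<open>x\<close> sees label \<open>a\<close> in every later saturated state that leaves
  \<open>x\<close> unlabelled: the second alternative says that \<open>\<psi> q\<close> has room to grow up to \<open>x\<close>, which
  saturation excludes.
\<close>

definition guarded :: "'a set \<Rightarrow> ('a \<Rightarrow> nat) \<Rightarrow> ('a \<Rightarrow> nat) \<Rightarrow> nat \<Rightarrow> 'a \<Rightarrow> bool" where
  "guarded U \<psi> b a x \<longleftrightarrow> (\<exists>q\<in>rim U x. \<exists>j. 0 < j \<and> j \<le> L \<and> (q, x) \<in> (E \<inter> UNIV \<times> comp U x) ^^ j \<and>
     (a \<in> seen U \<psi> x \<and> a \<le> \<psi> q \<and> (\<forall>z\<in>rim U x. \<psi> z < a \<longrightarrow> k * L \<le> load U \<psi> b x z) \<or>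
      load U \<psi> b x q + j \<le> k * L))"

text \<open>If \<open>p\<close> lies in the component, the walk from \<open>q\<close> is cut at its
  last vertex \<open>r\<close> outside the new component. Either \<open>r\<close> is
  \<open>q\<close>, or \<open>r\<close> is \<open>p\<close> and the walk has become strictly
  shorter.\<close>

lemma step_guarded:
  assumes "valid U \<psi> b" "step U \<psi> b p c \<beta>" "x \<in> U" "x \<noteq> p" "guarded U \<psi> b a x"
  shows "guarded (U - {p}) (\<psi>(p := c)) (b(p := \<beta>)) a x"
proof (cases "p \<in> comp U x")
  case False
  have pU: "p \<in> U" by (rule step_in[OF assms(2)])
  have p: "p \<notin> rim U x" using pU by (simp add: rim_def)
  note eqs = comp_rim_remove_other[OF assms(3) pU False] seen_load_remove_other[OF assms(3) pU False]
  obtain q j where q: "q \<in> rim U x" "0 < j \<and> j \<le> L \<and> (q, x) \<in> (E \<inter> UNIV \<times> comp U x) ^^ j \<and>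
     (a \<in> seen U \<psi> x \<and> a \<le> \<psi> q \<and> (\<forall>z\<in>rim U x. \<psi> z < a \<longrightarrow> k * L \<le> load U \<psi> b x z) \<or>
      load U \<psi> b x q + j \<le> k * L)" using assms(5) unfolding guarded_def by blast
  have "q \<noteq> p" using q(1) p by metis
  then show ?thesis
    unfolding guarded_def eqs(1-3) using q p by (intro bexI[of _ q] exI[of _ j]) (auto simp: eqs(4))
next
  case True
  let ?U = "U - {p}" and ?\<psi> = "\<psi>(p := c)" and ?b = "b(p := \<beta>)"
  note ld = step_load[OF assms(1-4)]
  have U: "p \<in> U" "x \<in> ?U" using step_in[OF assms(2)] assms(3,4) by auto
  have rp: "rim U p = rim U x" using rim_cong[OF True] .
  obtain q j where q: "q \<in> rim U x" "0 < j" "j \<le> L" "(q, x) \<in> (E \<inter> UNIV \<times> comp U x) ^^ j"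
    and qd: "a \<in> seen U \<psi> x \<and> a \<le> \<psi> q \<and> (\<forall>z\<in>rim U x. \<psi> z < a \<longrightarrow> k * L \<le> load U \<psi> b x z) \<or>
      load U \<psi> b x q + j \<le> k * L" using assms(5) unfolding guarded_def by blast
  have "q \<notin> comp ?U x" using q(1) component_subset[OF U(2), of E] by (auto simp: rim_def)
  from walk_last_exit[OF q(4) component_refl this] obtain r i z where
    r: "0 < i" "i \<le> j" "i < j \<or> r = q" "r \<notin> comp ?U x" "r \<in> insert q (comp U x)"
      "z \<in> comp ?U x" "(r, z) \<in> E" "(r, x) \<in> (E \<inter> UNIV \<times> comp ?U x) ^^ i" by blast
  have rr: "r \<in> rim ?U x" by (rule exit_rim[OF U(2) r(4,6,7)])
  have rq: "r = q \<or> r = p \<and> i < j"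
    using rr r(3,5) component_subset[OF assms(3), of E] by (auto simp: rim_def)
  have iL: "i \<le> L" using r(2) q(3) by simp
  have "?thesis" if lo: "a \<in> seen U \<psi> x" "a \<le> \<psi> q"
    "\<forall>z\<in>rim U x. \<psi> z < a \<longrightarrow> k * L \<le> load U \<psi> b x z"
  proof -
    \<comment> \<open>Labels older than \<open>a\<close> are full, so none of them can grow, and a
      created label is younger than \<open>a\<close>.\<close>
    have ac: "a \<le> c" using assms(2)[unfolded step_def]
    proof (elim disjE exE conjE)
      fix q0 assume "absorb_at U \<psi> b p q0" "c = \<psi> q0"
      then have "q0 \<in> rim U x" "load U \<psi> b x q0 < k * L" "c = \<psi> q0"
        using rp load_cong[OF True] by (auto simp: absorb_at_def)
      then show ?thesis using lo(3) by (meson not_le)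
    next
      assume "create_at U \<psi> b p c"
      then show ?thesis using lo(1) by (force simp: create_at_def seen_def rim_def)
    qed
    then have ar: "a \<le> ?\<psi> r" using rq lo(2) by auto
    show ?thesis
    \<comment> \<open>The loss of a label older than that of \<open>r\<close> frees \<open>L\<close>
      units, enough for the remaining \<open>i\<close> steps. Without such a loss \<open>a\<close>
      stays in view, as an older label or as that of \<open>r\<close>, and the loads of labels older
      than \<open>a\<close> do not change.\<close>
    proof (cases "\<exists>m\<in>seen U \<psi> x. m < ?\<psi> r \<and> m \<notin> seen ?U ?\<psi> x")
      case True
      then have "load ?U ?\<psi> ?b x r + i \<le> k * L" using ld(4)[OF rr] iL by fastforce
      then show ?thesis unfolding guarded_def using rr r iL by blast
    next
      case False
      have "?\<psi> r \<in> seen ?U ?\<psi> x" using rr by (simp add: seen_def)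
      then have as: "a \<in> seen ?U ?\<psi> x" using False lo(1) ar by (cases "a = ?\<psi> r") auto
      have "k * L \<le> load ?U ?\<psi> ?b x z" if z: "z \<in> rim ?U x" "?\<psi> z < a" for z
      proof -
        have zp: "z \<noteq> p" using z(2) ac by auto
        then have zr: "z \<in> rim U x" using z(1) rim_remove[OF assms(3,4)] by auto
        have "{m \<in> seen U \<psi> x. m < ?\<psi> z} \<subseteq> {m \<in> seen ?U ?\<psi> x. m < ?\<psi> z}"
          using False z(2) ar by fastforce
        then have "{m \<in> seen ?U ?\<psi> x. m < ?\<psi> z} = {m \<in> seen U \<psi> x. m < ?\<psi> z}"
          using step_lower[OF assms(1-4) z(1)] by blast
        then have "load ?U ?\<psi> ?b x z = load U \<psi> b x z" using zp by (simp add: load_def)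
        then show ?thesis using lo(3) zr z(2) zp by simp
      qed
      then show ?thesis unfolding guarded_def using rr r iL as ar by blast
    qed
  qed
  moreover have "?thesis" if hi: "load U \<psi> b x q + j \<le> k * L"
    using assms(2)[unfolded step_def]
  proof (elim disjE exE conjE)
    fix q0 assume q0: "absorb_at U \<psi> b p q0" "c = \<psi> q0" "\<beta> = b q0 + 1"
    \<comment> \<open>The growing label has least load. If \<open>r\<close> is \<open>p\<close>, its
      load is thus at most one more than that of \<open>q\<close>, and the shorter walk pays for
      this unit.\<close>
    have le: "load U \<psi> b x q0 \<le> load U \<psi> b x q"
      using q0(1) q(1) rp load_cong[OF True] by (auto simp: absorb_at_def)
    have "q \<noteq> p" using q(1) U by (auto simp: rim_def)
    then have "load ?U ?\<psi> ?b x r + i \<le> k * L"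
      using rq ld(2)[OF rr] ld(3)[OF rr q0] le hi r(2) by fastforce
    then show ?thesis unfolding guarded_def using rr r iL by blast
  next
    assume "create_at U \<psi> b p c"
    then have "k * L \<le> load U \<psi> b x q" using q(1) assms(3)
      by (auto simp: create_at_def saturated_def)
    then show ?thesis using hi q(2) by simp
  qed
  ultimately show ?thesis using qd by blast
qed

text \<open>The last vertex of the walk outside the new component carries a seen label that is at
  least \<open>a\<close>, hence strictly younger than the lost \<open>a\<close>. The loss gives it
  \<open>L\<close> units of room, and the rest of the walk has length at most
  \<open>L\<close>.\<close>

lemma step_loss_guarded:
  assumes "valid U \<psi> b" "step U \<psi> b p c \<beta>" "x \<in> U" "x \<noteq> p"
    and "a \<in> seen U \<psi> x" "a \<notin> seen (U - {p}) (\<psi>(p := c)) x"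
    and "(w, x) \<in> (E \<inter> UNIV \<times> Z) ^^ i" "i \<le> L" "w \<notin> comp (U - {p}) x"
    and "\<forall>z\<in>insert w Z. z \<notin> U - {p} \<longrightarrow> a \<le> (\<psi>(p := c)) z"
  shows "guarded (U - {p}) (\<psi>(p := c)) (b(p := \<beta>)) a x"
proof -
  let ?U = "U - {p}" and ?\<psi> = "\<psi>(p := c)" and ?b = "b(p := \<beta>)"
  have U: "x \<in> ?U" using assms by auto
  from walk_last_exit[OF assms(7) component_refl assms(9)] obtain r j z where
    r: "0 < j" "j \<le> i" "r \<notin> comp ?U x" "r \<in> insert w Z"
      "z \<in> comp ?U x" "(r, z) \<in> E" "(r, x) \<in> (E \<inter> UNIV \<times> comp ?U x) ^^ j" by blast
  have rr: "r \<in> rim ?U x" by (rule exit_rim[OF U r(3,5,6)])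
  then have "?\<psi> r \<in> seen ?U ?\<psi> x" by (simp add: seen_def)
  moreover have "a \<le> ?\<psi> r" using rr r(4) assms(10) unfolding rim_def by blast
  ultimately have "a < ?\<psi> r" using assms(6) by (metis le_neq_implies_less)
  then have "load ?U ?\<psi> ?b x r + L \<le> k * L" using step_load(4)[OF assms(1-4) rr assms(5) _ assms(6)]
    by simp
  then have "load ?U ?\<psi> ?b x r + j \<le> k * L" "j \<le> L" using r(2) assms(8) by auto
  then show ?thesis unfolding guarded_def using rr r by blast
qed

section \<open>Runs of absorptions\<close>

text \<open>Steps are prepended, so induction treats the first step and carries the invariants
  forward to a fixed final state.\<close>

inductive absorbs :: "'a set \<Rightarrow> ('a \<Rightarrow> nat) \<Rightarrow> ('a \<Rightarrow> nat) \<Rightarrow> 'a set \<Rightarrow> ('a \<Rightarrow> nat) \<Rightarrow> ('a \<Rightarrow> nat) \<Rightarrow> bool" where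
  absorbs_refl: "absorbs U \<psi> b U \<psi> b"
| absorbs_step: "absorb_at U \<psi> b p q \<Longrightarrow>
    absorbs (U - {p}) (\<psi>(p := \<psi> q)) (b(p := b q + 1)) U' \<psi>' b' \<Longrightarrow> absorbs U \<psi> b U' \<psi>' b'"

lemma absorb_step: "absorb_at U \<psi> b p q \<Longrightarrow> step U \<psi> b p (\<psi> q) (b q + 1)"
  by (auto simp: step_def)

lemma create_step: "create_at U \<psi> b p c \<Longrightarrow> step U \<psi> b p c 0"
  by (auto simp: step_def)

lemma absorbs_subset: "absorbs U \<psi> b U' \<psi>' b' \<Longrightarrow> U' \<subseteq> U \<and> (\<forall>v. v \<notin> U \<longrightarrow> \<psi>' v = \<psi> v)"
proof (induction rule: absorbs.induct)
  case (absorbs_step U \<psi> b p q U' \<psi>' b')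
  then have "p \<in> U" by (simp add: absorb_at_def)
  then show ?case using absorbs_step.IH by auto
qed auto

lemma absorbs_valid: "absorbs U \<psi> b U' \<psi>' b' \<Longrightarrow> valid U \<psi> b \<Longrightarrow> valid U' \<psi>' b'"
proof (induction rule: absorbs.induct)
  case (absorbs_step U \<psi> b p q U' \<psi>' b')
  show ?case
    by (rule absorbs_step.IH[OF step_valid[OF absorbs_step.prems absorb_step[OF absorbs_step.hyps(1)]]])
qed

lemma absorbs_guarded:
  "absorbs U \<psi> b U' \<psi>' b' \<Longrightarrow> valid U \<psi> b \<Longrightarrow> x \<in> U' \<Longrightarrow> guarded U \<psi> b a x \<Longrightarrow> guarded U' \<psi>' b' a x"
proof (induction rule: absorbs.induct)
  case (absorbs_step U \<psi> b p q U' \<psi>' b')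
  have "x \<in> U - {p}" using absorbs_subset[OF absorbs_step.hyps(2)] absorbs_step.prems(2) by auto
  then have "x \<in> U" "x \<noteq> p" by auto
  note g = step_guarded[OF absorbs_step.prems(1) absorb_step[OF absorbs_step.hyps(1)] this absorbs_step.prems(3)]
  show ?case
    by (rule absorbs_step.IH[OF
          step_valid[OF absorbs_step.prems(1) absorb_step[OF absorbs_step.hyps(1)]]
          absorbs_step.prems(2) g])
qed

text \<open>Absorptions bring no new label into view, so whatever label \<open>w\<close> finally
  receives was visible to it at the beginning.\<close>

lemma absorbs_label: "absorbs U \<psi> b U' \<psi>' b' \<Longrightarrow> w \<in> U \<Longrightarrow> w \<notin> U' \<Longrightarrow> \<psi>' w \<in> seen U \<psi> w"
proof (induction rule: absorbs.induct)
  case (absorbs_step U \<psi> b p q U' \<psi>' b')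
  show ?case
  proof (cases "w = p")
    case True
    have "\<psi>' p = \<psi> q" using absorbs_subset[OF absorbs_step.hyps(2)] by auto
    then show ?thesis using absorbs_step.hyps(1) True by (auto simp: absorb_at_def seen_def)
  next
    case False
    then have "\<psi>' w \<in> seen (U - {p}) (\<psi>(p := \<psi> q)) w"
      by (intro absorbs_step.IH) (use absorbs_step.prems False in auto)
    then show ?thesis using absorb_seen[OF absorbs_step.hyps(1) absorbs_step.prems(1) False]
      by (rule rev_subsetD)
  qed
qed simp

text \<open>While some label has room, one of least load on the rim of that component can grow, and
  each growth removes a vertex from \<open>U\<close>.\<close>

lemma absorbs_saturated:
  assumes "valid U \<psi> b"
  shows "\<exists>U' \<psi>' b'. absorbs U \<psi> b U' \<psi>' b' \<and> saturated U' \<psi>' b'"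
  using assms
proof (induction "card U" arbitrary: U \<psi> b rule: less_induct)
  case less
  show ?case
  proof (cases "saturated U \<psi> b")
    case True
    then show ?thesis using absorbs_refl by blast
  next
    case False
    then obtain x r where x: "x \<in> U" and r: "r \<in> rim U x" "load U \<psi> b x r < k * L"
      unfolding saturated_def by (meson not_le)
    define q where "q = arg_min_on (load U \<psi> b x) (rim U x)"
    have ne: "rim U x \<noteq> {}" using r(1) by auto
    have q: "q \<in> rim U x" "\<And>s. s \<in> rim U x \<Longrightarrow> load U \<psi> b x q \<le> load U \<psi> b x s"
      unfolding q_def
        by (rule arg_min_if_finite(1)[OF finite_rim ne]) (rule arg_min_least[OF finite_rim ne])
    obtain p where p: "p \<in> comp U x" "(q, p) \<in> E" using q(1) by (auto simp: rim_def)
    have pU: "p \<in> U" using p(1) component_subset[OF x] by auto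
    have ab: "absorb_at U \<psi> b p q"
      unfolding absorb_at_def using pU p q q(2)[OF r(1)] r(2) by (simp add: rim_cong load_cong)
    have "finite U" using less.prems finite_V finite_subset unfolding valid_def by blast
    then have "card (U - {p}) < card U" using pU by (rule card_Diff1_less)
    from less.hyps[OF this step_valid[OF less.prems absorb_step[OF ab]]]
    show ?thesis using absorbs_step[OF ab] by blast
  qed
qed

text \<open>Since \<open>j\<close> is positive, the second alternative would leave a load below
  \<open>k * L\<close>, against saturation.\<close>

lemma guarded_seen:
  assumes "saturated U \<psi> b" "x \<in> U" "guarded U \<psi> b a x"
  shows "a \<in> seen U \<psi> x"
  using assms unfolding guarded_def saturated_def by fastforce

text \<open>A step that loses \<open>a\<close> makes it guarded; this persists to the saturated end,
  where \<open>guarded_seen\<close> gives the claim.\<close>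

lemma absorbs_keep:
  assumes "absorbs U \<psi> b U' \<psi>' b'" "valid U \<psi> b" "saturated U' \<psi>' b'"
    and "x \<in> U'" "w \<notin> U'" "\<psi>' w = a" "(w, x) \<in> (E \<inter> UNIV \<times> Z) ^^ i" "i \<le> L"
    and "\<forall>z\<in>insert w Z. z \<notin> U' \<longrightarrow> a \<le> \<psi>' z" "a \<in> seen U \<psi> x"
  shows "a \<in> seen U' \<psi>' x"
  using assms
proof (induction rule: absorbs.induct)
  case (absorbs_step U \<psi> b p q U' \<psi>' b')
  let ?U = "U - {p}" and ?\<psi> = "\<psi>(p := \<psi> q)" and ?b = "b(p := b q + 1)"
  note st = absorb_step[OF absorbs_step.hyps(1)]
  have v: "valid ?U ?\<psi> ?b" by (rule step_valid[OF absorbs_step.prems(1) st])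
  note sub = absorbs_subset[OF absorbs_step.hyps(2)]
  have x: "x \<in> ?U" "x \<in> U" "x \<noteq> p" using sub absorbs_step.prems(3) by auto
  show ?case
  proof (cases "a \<in> seen ?U ?\<psi> x")
    case True
    show ?thesis by (rule absorbs_step.IH[OF v absorbs_step.prems(2-8) True])
  next
    case False
    \<comment> \<open>Otherwise \<open>w\<close> would share the view of \<open>x\<close> and could
      no longer receive \<open>a\<close>.\<close>
    have "w \<notin> comp ?U x"
    proof
      assume w: "w \<in> comp ?U x"
      then have "w \<in> ?U" using component_subset[OF x(1)] by blast
      then have "\<psi>' w \<in> seen ?U ?\<psi> w"
        using absorbs_label[OF absorbs_step.hyps(2)] absorbs_step.prems(4) by blast
      then show False using seen_cong[OF w] absorbs_step.prems(5) False by metis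
    qed
    moreover have "\<forall>z\<in>insert w Z. z \<notin> ?U \<longrightarrow> a \<le> ?\<psi> z"
      using absorbs_step.prems(8) sub by (metis subsetD)
    ultimately have "guarded ?U ?\<psi> ?b a x"
      using step_loss_guarded[OF absorbs_step.prems(1) st x(2,3) absorbs_step.prems(9) False absorbs_step.prems(6,7)] by blast
    then show ?thesis
      using guarded_seen[OF absorbs_step.prems(2,3)] absorbs_guarded[OF absorbs_step.hyps(2) v absorbs_step.prems(3)] by blast
  qed
qed simp

lemma walk_component:
  assumes "(w, x) \<in> (E \<inter> UNIV \<times> Z) ^^ i" "insert w Z \<subseteq> U"
  shows "x \<in> comp U w"
  using assms(1)
proof (induction i arbitrary: x)
  case 0
  then show ?case by (simp add: component_refl)
next
  case (Suc i)
  then obtain z where z: "(w, z) \<in> (E \<inter> UNIV \<times> Z) ^^ i" "(z, x) \<in> E" "x \<in> Z" by auto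
  have "z \<in> comp U w" by (rule Suc.IH[OF z(1)])
  moreover from this have "z \<in> U" using component_subset[of w U E] assms(2) by auto
  ultimately show ?case using z assms(2) by (auto intro: component_step)
qed

text \<open>If \<open>p\<close> did not border the remaining component of \<open>x\<close>, that
  component would be closed under steps in \<open>U\<close> and no walk from \<open>x\<close> would
  reach \<open>p\<close>.\<close>

lemma removed_in_rim:
  assumes "x \<in> U" "p \<in> U" "U \<subseteq> V" "x \<noteq> p" "p \<in> comp U x"
  shows "p \<in> rim (U - {p}) x"
proof (rule ccontr)
  assume n: "p \<notin> rim (U - {p}) x"
  have x: "x \<in> U - {p}" using assms by auto
  have "(x, z) \<in> (E \<inter> U \<times> U)\<^sup>* \<Longrightarrow> z \<in> comp (U - {p}) x" for z
  proof (induction rule: rtrancl_induct)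
    case base
    show ?case by (rule component_refl)
  next
    case (step y z)
    have y: "y \<in> U - {p}" using step.IH component_subset[OF x] by blast
    have "z \<noteq> p"
      using exit_rim[OF x _ step.IH, of p] step.hyps(2) n symE component_subset[OF x, of E] by blast
    then show ?case using step y by (auto intro: component_step)
  qed
  then have "p \<in> comp (U - {p}) x" using assms(5) by (simp add: component_def)
  then show False using component_subset[OF x, of E] by blast
qed

section \<open>Phases: a new centre followed by absorption until saturation\<close>

definition phase :: "'a set \<Rightarrow> ('a \<Rightarrow> nat) \<Rightarrow> ('a \<Rightarrow> nat) \<Rightarrow> 'a \<Rightarrow> nat \<Rightarrow>
    'a set \<Rightarrow> ('a \<Rightarrow> nat) \<Rightarrow> ('a \<Rightarrow> nat) \<Rightarrow> bool" where
  "phase U \<psi> b p c U' \<psi>' b' \<longleftrightarrow> valid U \<psi> b \<and> create_at U \<psi> b p c \<and>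
     absorbs (U - {p}) (\<psi>(p := c)) (b(p := 0)) U' \<psi>' b' \<and> saturated U' \<psi>' b'"

lemma phase_valid: "phase U \<psi> b p c U' \<psi>' b' \<Longrightarrow> valid U' \<psi>' b'"
  unfolding phase_def using absorbs_valid step_valid create_step by blast

lemma phase_subset:
  assumes "phase U \<psi> b p c U' \<psi>' b'"
  shows "U' \<subset> U" "v \<notin> U \<Longrightarrow> \<psi>' v = \<psi> v" "\<psi>' p = c"
proof -
  have "p \<in> U" using assms by (auto simp: phase_def create_at_def)
  moreover have "U' \<subseteq> U - {p} \<and> (\<forall>v. v \<notin> U - {p} \<longrightarrow> \<psi>' v = (\<psi>(p := c)) v)"
    using assms absorbs_subset unfolding phase_def by blast
  ultimately show "U' \<subset> U" "v \<notin> U \<Longrightarrow> \<psi>' v = \<psi> v" "\<psi>' p = c" by auto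
qed

text \<open>Validity supplies a hub bag that meets the component; any vertex in the intersection can
  be the new centre.\<close>

lemma ex_phase:
  assumes "valid U \<psi> b" "saturated U \<psi> b" "U \<noteq> {}"
  shows "\<exists>p c U' \<psi>' b'. phase U \<psi> b p c U' \<psi>' b'"
proof -
  obtain x where x: "x \<in> U" using assms(3) by blast
  obtain t p where t: "hub U \<psi> x t" "p \<in> B t" "p \<in> comp U x"
    using assms(1) x unfolding valid_def by blast
  have "finite (\<psi> ` V)" using finite_V by simp
  then have "\<forall>v\<in>V. \<psi> v < Suc (Max (\<psi> ` V))" using less_Suc_eq_le by auto
  moreover have "p \<in> U" using t(3) component_subset[OF x] by blast
  moreover have "hub U \<psi> p t" using t(1) seen_cong[OF t(3)] by (simp add: hub_def)
  ultimately have c: "create_at U \<psi> b p (Suc (Max (\<psi> ` V)))"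
    using assms(2) t(2) unfolding create_at_def by blast
  then show ?thesis
    using absorbs_saturated[OF step_valid[OF assms(1) create_step[OF c]]] assms(1)
    unfolding phase_def by blast
qed

lemma phase_guarded:
  assumes "phase U \<psi> b p c U' \<psi>' b'" "x \<in> U'" "guarded U \<psi> b a x"
  shows "guarded U' \<psi>' b' a x"
proof -
  have "x \<in> U - {p}" using assms absorbs_subset unfolding phase_def by blast
  then show ?thesis
    using assms step_valid step_guarded[OF _ create_step] create_step absorbs_guarded
    unfolding phase_def by (metis DiffD1 DiffD2 singletonI)
qed

lemma phase_label:
  assumes "phase U \<psi> b p c U' \<psi>' b'" "w \<in> U" "w \<notin> U'"
  shows "\<psi>' w \<in> seen U \<psi> w \<or> \<psi>' w = c \<and> p \<in> comp U w"
proof (cases "w = p")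
  case True
  then show ?thesis using phase_subset(3)[OF assms(1)] component_refl by metis
next
  case False
  have p: "p \<in> U" "step U \<psi> b p c 0"
    using assms(1) create_step unfolding phase_def create_at_def by blast+
  have "\<psi>' w \<in> seen (U - {p}) (\<psi>(p := c)) w"
    using absorbs_label assms False unfolding phase_def by blast
  then show ?thesis
    using step_seen[OF p(2) assms(2) False] seen_load_remove_other(1)[OF assms(2) p(1)] by blast
qed

text \<open>Here \<open>w\<close> is labelled during the phase and \<open>x\<close> is not. If the
  label of \<open>w\<close> were lost from the view of \<open>x\<close>, by the creation or by an
  absorption, it would become guarded and hence be seen at the end. With saturation, the walk then
  gives the first alternative of \<open>guarded\<close>.\<close>

lemma phase_keep:
  assumes "phase U \<psi> b p c U' \<psi>' b'" "x \<in> U'" "w \<notin> U'"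
    and "(w, x) \<in> (E \<inter> UNIV \<times> Z) ^^ i" "i \<le> L" "insert w Z \<subseteq> U"
    and "\<forall>z\<in>insert w Z. z \<notin> U' \<longrightarrow> \<psi>' w \<le> \<psi>' z"
  shows "guarded U' \<psi>' b' (\<psi>' w) x"
proof -
  let ?U = "U - {p}" and ?\<psi> = "\<psi>(p := c)" and ?b = "b(p := 0)" and ?a = "\<psi>' w"
  have ph: "valid U \<psi> b" "create_at U \<psi> b p c" "absorbs ?U ?\<psi> ?b U' \<psi>' b'" "saturated U' \<psi>' b'"
    using assms(1) by (auto simp: phase_def)
  note st = create_step[OF ph(2)]
  note v = step_valid[OF ph(1) st]
  note sub = absorbs_subset[OF ph(3)]
  have U: "U \<subseteq> V" "p \<in> U" using ph(1,2) by (auto simp: valid_def create_at_def)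
  have x: "x \<in> ?U" "x \<in> U" "x \<noteq> p" using sub assms(2) by auto
  have xw: "x \<in> comp U w" by (rule walk_component[OF assms(4,6)])
  have as: "?a \<in> seen U' \<psi>' x"
  proof (cases "?a \<in> seen ?U ?\<psi> x")
    case True
    then show ?thesis using absorbs_keep[OF ph(3) v ph(4) assms(2,3) refl assms(4,5,7)] by blast
  next
    case False
    \<comment> \<open>If the centre lay in the component of \<open>w\<close>, which is that of
      \<open>x\<close>, it would border what remains of it, and \<open>x\<close> would see
      \<open>c\<close>.\<close>
    have "\<not> p \<in> comp U w" if "?a = c"
    proof
      assume "p \<in> comp U w"
      then have "p \<in> rim ?U x"
        using removed_in_rim[OF x(2) U(2,1) x(3)] component_eq[OF sym_E xw] by blast
      then have "c \<in> seen ?U ?\<psi> x" unfolding seen_def by (metis fun_upd_same imageI)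
      then show False using False that by simp
    qed
    then have "?a \<in> seen U \<psi> x"
      using phase_label[OF assms(1) _ assms(3)] assms(6) seen_cong[OF xw] by blast
    moreover have "w \<notin> comp ?U x"
    proof
      assume w: "w \<in> comp ?U x"
      then have "w \<in> ?U" using component_subset[OF x(1)] by blast
      then have "?a \<in> seen ?U ?\<psi> w" using absorbs_label[OF ph(3)] assms(3) by blast
      then show False using seen_cong[OF w] False by metis
    qed
    moreover have "\<forall>z\<in>insert w Z. z \<notin> ?U \<longrightarrow> ?a \<le> ?\<psi> z"
      using assms(7) sub by (metis subsetD)
    ultimately have "guarded ?U ?\<psi> ?b ?a x"
      using step_loss_guarded[OF ph(1) st x(2,3) _ False assms(4,5)] by blast
    then show ?thesis using guarded_seen[OF ph(4) assms(2)] absorbs_guarded[OF ph(3) v assms(2)]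
      by blast
  qed
  have "w \<notin> comp U' x" using component_subset[OF assms(2)] assms(3) by blast
  from walk_last_exit[OF assms(4) component_refl this] obtain q j z where
    q: "0 < j" "j \<le> i" "q \<notin> comp U' x" "q \<in> insert w Z" "z \<in> comp U' x" "(q, z) \<in> E"
      "(q, x) \<in> (E \<inter> UNIV \<times> comp U' x) ^^ j" by blast
  have qr: "q \<in> rim U' x" by (rule exit_rim[OF assms(2) q(3,5,6)])
  then have "?a \<le> \<psi>' q" using assms(7) q(4) unfolding rim_def by blast
  moreover have "\<forall>z\<in>rim U' x. \<psi>' z < ?a \<longrightarrow> k * L \<le> load U' \<psi>' b' x z"
    using ph(4) assms(2) unfolding saturated_def by blast
  moreover have "j \<le> L" using q(2) assms(5) by linarith
  ultimately show ?thesis unfolding guarded_def using qr q(1,7) as by blast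
qed

definition meet :: "('a \<Rightarrow> nat) \<Rightarrow> nat \<Rightarrow> nat \<Rightarrow> bool" where
  "meet \<psi> m n \<longleftrightarrow> (\<exists>t\<in>N. m \<in> \<psi> ` B t \<and> n \<in> \<psi> ` B t)"

lemma meet_sym: "meet \<psi> m n \<Longrightarrow> meet \<psi> n m"
  by (auto simp: meet_def)

text \<open>The bag chosen with a new centre contains it together with all labels seen; without a
  centre in the component, a hub suffices. Later phases do not change these labels, so
  \<open>\<chi>\<close> may be any labelling that extends \<open>\<psi>'\<close>.\<close>

lemma phase_meet:
  assumes "phase U \<psi> b p c U' \<psi>' b'" "x \<in> U" "\<forall>v. v \<notin> U' \<longrightarrow> \<chi> v = \<psi>' v"
    and "m \<in> seen U \<psi> x \<or> m = c \<and> p \<in> comp U x" "n \<in> seen U \<psi> x \<or> n = c \<and> p \<in> comp U x"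
  shows "meet \<chi> m n"
proof -
  note sub = phase_subset[OF assms(1)]
  have pU: "create_at U \<psi> b p c" "valid U \<psi> b" using assms(1) by (auto simp: phase_def)
  have "absorbs (U - {p}) (\<psi>(p := c)) (b(p := 0)) U' \<psi>' b'" using assms(1) by (simp add: phase_def)
  then have "p \<notin> U'" using absorbs_subset by blast
  then have cp: "\<chi> p = c" using assms(3) sub(3) by simp
  have "\<chi> v = \<psi> v" if "v \<notin> U" for v using that assms(3) sub(1,2) by auto
  then have old: "l \<in> \<chi> ` B t" if "hub U \<psi> x t" "l \<in> seen U \<psi> x" for t l
    using that unfolding hub_def by force
  show ?thesis
  proof (cases "p \<in> comp U x")
    case True
    obtain t where "hub U \<psi> p t" "p \<in> B t" using pU(1) by (auto simp: create_at_def)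
    then have t: "hub U \<psi> x t" "c \<in> \<chi> ` B t" using seen_cong[OF True] cp by (auto simp: hub_def)
    then show ?thesis using old assms(4,5) unfolding meet_def hub_def by blast
  next
    case False
    obtain t where t: "hub U \<psi> x t" using pU(2) assms(2) unfolding valid_def by blast
    then show ?thesis using old[OF t] assms(4,5) False unfolding meet_def hub_def by blast
  qed
qed

subsection \<open>Relabelling by balls\<close>

abbreviation ball :: "'a \<Rightarrow> 'a set" where
  "ball u \<equiv> {w. near E (L div 2) u w}"

lemma walk_in_ball: "(u, y) \<in> E ^^ i \<Longrightarrow> i \<le> L div 2 \<Longrightarrow> (u, y) \<in> (E \<inter> UNIV \<times> ball u) ^^ i"
proof (induction i arbitrary: y)
  case (Suc i)
  then obtain z where "(u, z) \<in> E ^^ i" "(z, y) \<in> E" by auto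
  moreover have "near E (Suc i) u y" using Suc.prems(1) by (rule nearI)
  then have "y \<in> ball u" using Suc.prems(2) by (simp add: near_mono)
  ultimately show ?case using Suc by auto
qed auto

lemma walk_in_ball': "(w, u) \<in> E ^^ i \<Longrightarrow> i \<le> L div 2 \<Longrightarrow> (w, u) \<in> (E \<inter> UNIV \<times> ball u) ^^ i"
proof (induction i arbitrary: w)
  case (Suc i)
  then obtain z where z: "(w, z) \<in> E" "(z, u) \<in> E ^^ i" by (meson relpow_Suc_D2)
  have "near E i u z" by (rule near_sym[OF sym_E nearI[OF z(2)]])
  then have "z \<in> ball u" using near_mono[of E i u z "L div 2"] Suc.prems(2) by simp
  then have "(w, z) \<in> E \<inter> UNIV \<times> ball u" using z(1) by blast
  moreover have "(z, u) \<in> (E \<inter> UNIV \<times> ball u) ^^ i" using Suc.IH[OF z(2)] Suc.prems(2) by simp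
  ultimately show ?case by (rule relpow_Suc_I2)
qed auto

lemma relpow_mono_rel:
  fixes R S :: "('b \<times> 'b) set"
  shows "(x, y) \<in> R ^^ n \<Longrightarrow> R \<subseteq> S \<Longrightarrow> (x, y) \<in> S ^^ n"
proof (induction n arbitrary: y)
  case (Suc n)
  then obtain z where "(x, z) \<in> R ^^ n" "(z, y) \<in> R" by auto
  then show ?case using Suc by auto
qed auto

text \<open>Walk from \<open>w\<close> to \<open>u\<close> and on towards \<open>v\<close>, stopping
  \<open>L div 2\<close> steps before \<open>v\<close>, or at \<open>u\<close> if \<open>v\<close>
  is that close. The total length is at most \<open>L\<close>.\<close>

lemma walk_between_balls:
  assumes "near E L u v" "w \<in> ball u"
  shows "\<exists>x\<in>ball v. \<exists>i\<le>L. (w, x) \<in> (E \<inter> UNIV \<times> (ball u \<union> ball v)) ^^ i"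
proof -
  let ?h = "L div 2" and ?R = "E \<inter> UNIV \<times> (ball u \<union> ball v)"
  obtain m' where m': "m' \<le> ?h" "(w, u) \<in> E ^^ m'"
    using near_sym[OF sym_E, of ?h u w] assms(2) unfolding near_def by blast
  have wu: "(w, u) \<in> ?R ^^ m'" by (rule relpow_mono_rel[OF walk_in_ball'[OF m'(2,1)]]) auto
  obtain m where m: "m \<le> L" "(u, v) \<in> E ^^ m" using assms(1) unfolding near_def by blast
  define i where "i = m - ?h"
  have "i + (m - i) = m" by (simp add: i_def)
  then have "(u, v) \<in> E ^^ (i + (m - i))" using m(2) by simp
  then obtain x where x: "(u, x) \<in> E ^^ i" "(x, v) \<in> E ^^ (m - i)"
    unfolding relpow_add by blast
  have "near E ?h x v" unfolding near_def using x(2) by (intro exI[of _ "m - i"]) (auto simp: i_def)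
  then have xb: "x \<in> ball v" using near_sym[OF sym_E] by blast
  have "(u, x) \<in> ?R ^^ i"
  proof (cases i)
    case (Suc j)
    then obtain y where y: "(u, y) \<in> E ^^ j" "(y, x) \<in> E" using x(1) by auto
    \<comment> \<open>For odd \<open>L\<close> the stretch \<open>i\<close> can be
      \<open>L div 2 + 1\<close>. All its vertices but the last lie in \<open>ball u\<close>, and
      the last lies in \<open>ball v\<close>.\<close>
    have "j \<le> ?h" using Suc m(1) by (auto simp: i_def)
    then have "(u, y) \<in> ?R ^^ j" by (intro relpow_mono_rel[OF walk_in_ball[OF y(1)]]) auto
    then show ?thesis using y(2) xb Suc by auto
  qed (use x in auto)
  then have "(w, x) \<in> ?R ^^ (m' + i)" unfolding relpow_add by (rule relcompI[OF wu])
  moreover have "m' + i \<le> L" using m'(1) m(1) by (auto simp: i_def)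
  ultimately show ?thesis using xb by blast
qed

lemma ball_component:
  assumes "ball v \<subseteq> U" "z \<in> ball v"
  shows "z \<in> comp U v"
proof -
  obtain i where "i \<le> L div 2" "(v, z) \<in> E ^^ i" using assms(2) unfolding near_def by blast
  then have "(v, z) \<in> (E \<inter> UNIV \<times> ball v) ^^ i" by (intro walk_in_ball)
  moreover have "v \<in> ball v" by (simp add: near_refl)
  then have "insert v (ball v) \<subseteq> U" using assms(1) by blast
  ultimately show ?thesis by (rule walk_component)
qed

text \<open>
  \<open>\<phi> u\<close> is the oldest label among the vertices of \<open>ball u\<close> that are labelled in the first phase
  reaching that ball.
\<close>

lemma ex_labelling:
  assumes "valid U \<psi> b" "saturated U \<psi> b"
  shows "\<exists>\<chi> d \<phi>. (\<forall>v. v \<notin> U \<longrightarrow> \<chi> v = \<psi> v) \<and> valid {} \<chi> d \<and>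
    (\<forall>u. ball u \<subseteq> U \<longrightarrow> \<phi> u \<in> \<chi> ` ball u) \<and>
    (\<forall>u v. ball u \<subseteq> U \<longrightarrow> ball v \<subseteq> U \<longrightarrow> near E L u v \<longrightarrow> meet \<chi> (\<phi> u) (\<phi> v)) \<and>
    (\<forall>a v. ball v \<subseteq> U \<longrightarrow> (\<exists>x\<in>ball v. guarded U \<psi> b a x) \<longrightarrow> meet \<chi> a (\<phi> v))"
  using assms
\<comment> \<open>The clause on guarded labels carries the case of a ball reached now and a ball
  reached only in a later phase.\<close>
proof (induction "card U" arbitrary: U \<psi> b rule: less_induct)
  case less
  show ?case
  proof (cases "U = {}")
    case True
    \<comment> \<open>No ball fits into the empty set, so the clauses about balls are vacuous
      here.\<close>
    have "ball u \<noteq> {}" for u using near_refl by fastforce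
    then show ?thesis using less.prems True
      by (intro exI[of _ \<psi>] exI[of _ b] exI[of _ undefined]) auto
  next
    case False
    obtain p c U' \<psi>' b' where ph: "phase U \<psi> b p c U' \<psi>' b'"
      using ex_phase[OF less.prems False] by blast
    note sub = phase_subset[OF ph]
    have "finite U" using less.prems finite_V finite_subset unfolding valid_def by blast
    then have "card U' < card U" using sub(1) by (rule psubset_card_mono)
    moreover have "saturated U' \<psi>' b'" using ph by (simp add: phase_def)
    ultimately have "\<exists>\<chi> d \<phi>. (\<forall>v. v \<notin> U' \<longrightarrow> \<chi> v = \<psi>' v) \<and> valid {} \<chi> d \<and>
        (\<forall>u. ball u \<subseteq> U' \<longrightarrow> \<phi> u \<in> \<chi> ` ball u) \<and>
        (\<forall>u v. ball u \<subseteq> U' \<longrightarrow> ball v \<subseteq> U' \<longrightarrow> near E L u v \<longrightarrow> meet \<chi> (\<phi> u) (\<phi> v)) \<and>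
        (\<forall>a v. ball v \<subseteq> U' \<longrightarrow> (\<exists>x\<in>ball v. guarded U' \<psi>' b' a x) \<longrightarrow> meet \<chi> a (\<phi> v))"
      by (intro less.hyps phase_valid[OF ph])
    then obtain \<chi> d \<phi> where
      chi: "\<forall>v. v \<notin> U' \<longrightarrow> \<chi> v = \<psi>' v" "valid {} \<chi> d"
      and in1: "\<forall>u. ball u \<subseteq> U' \<longrightarrow> \<phi> u \<in> \<chi> ` ball u"
      and near1: "\<forall>u v. ball u \<subseteq> U' \<longrightarrow> ball v \<subseteq> U' \<longrightarrow> near E L u v \<longrightarrow> meet \<chi> (\<phi> u) (\<phi> v)"
      and guard: "\<forall>a v. ball v \<subseteq> U' \<longrightarrow> (\<exists>x\<in>ball v. guarded U' \<psi>' b' a x) \<longrightarrow> meet \<chi> a (\<phi> v)"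
      by (elim exE conjE) (rule that)
    have guard1: "meet \<chi> a (\<phi> v)" if "ball v \<subseteq> U'" "x \<in> ball v" "guarded U' \<psi>' b' a x" for a v x
      using guard that by blast
    define \<phi>' where "\<phi>' u = (if ball u \<subseteq> U' then \<phi> u else Min (\<psi>' ` (ball u - U')))" for u
    have new: "\<exists>w\<in>ball u - U'. \<phi>' u = \<psi>' w \<and> (\<forall>z\<in>ball u - U'. \<psi>' w \<le> \<psi>' z)"
      if "ball u \<subseteq> U" "\<not> ball u \<subseteq> U'" for u
    proof -
      have "finite (ball u - U')" using that(1) \<open>finite U\<close> finite_subset by blast
      then have fin: "finite (\<psi>' ` (ball u - U'))" by simp
      moreover have "\<psi>' ` (ball u - U') \<noteq> {}" using that(2) by blast
      ultimately have "Min (\<psi>' ` (ball u - U')) \<in> \<psi>' ` (ball u - U')" by (rule Min_in)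
      then obtain w where w: "w \<in> ball u - U'" "Min (\<psi>' ` (ball u - U')) = \<psi>' w"
        by (rule imageE) auto
      have "\<psi>' w \<le> \<psi>' z" if "z \<in> ball u - U'" for z
        using Min_le[OF fin, of "\<psi>' z"] w(2) that by auto
      moreover have "\<phi>' u = \<psi>' w" using w(2) \<open>\<not> ball u \<subseteq> U'\<close> by (simp add: \<phi>'_def)
      ultimately show ?thesis using w(1) by blast
    qed
    \<comment> \<open>An untouched ball lies in one component, so the labels it receives in this
      phase are visible to that component or come from a centre in it.\<close>
    have label: "\<phi>' v \<in> seen U \<psi> x \<or> \<phi>' v = c \<and> p \<in> comp U x"
      if v: "ball v \<subseteq> U" "\<not> ball v \<subseteq> U'" and x: "x \<in> comp U v" for v x
    proof -
      obtain w where w: "w \<in> ball v" "w \<notin> U'" "\<phi>' v = \<psi>' w" using new[OF v] by blast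
      have "\<phi>' v \<in> seen U \<psi> w \<or> \<phi>' v = c \<and> p \<in> comp U w"
        using phase_label[OF ph, of w] w v(1) by auto
      moreover have "comp U w = comp U x"
        using component_eq[OF sym_E] ball_component[OF v(1) w(1)] x by metis
      ultimately show ?thesis using seen_cong component_refl by metis
    qed
    \<comment> \<open>If \<open>ball v\<close> is still untouched, \<open>phase_keep\<close> makes
      the label of \<open>u\<close> guarded at a vertex of it, and the induction hypothesis applies.
      Otherwise both labels arise in the same component in this phase, and \<open>phase_meet\<close>
      applies.\<close>
    have cross: "meet \<chi> (\<phi>' u) (\<phi>' v)"
      if u: "ball u \<subseteq> U" "\<not> ball u \<subseteq> U'" and v: "ball v \<subseteq> U" and n: "near E L u v" for u v
    proof -
      obtain w where w: "w \<in> ball u" "w \<notin> U'" "\<phi>' u = \<psi>' w"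
        and le: "\<forall>z\<in>ball u - U'. \<psi>' w \<le> \<psi>' z" using new[OF u] by blast
      obtain x i where x: "x \<in> ball v" "i \<le> L" "(w, x) \<in> (E \<inter> UNIV \<times> (ball u \<union> ball v)) ^^ i"
        using walk_between_balls[OF n w(1)] by blast
      have sU: "insert w (ball u \<union> ball v) \<subseteq> U" using u v w by auto
      show ?thesis
      proof (cases "ball v \<subseteq> U'")
        case True
        then have "\<forall>z\<in>insert w (ball u \<union> ball v). z \<notin> U' \<longrightarrow> \<psi>' w \<le> \<psi>' z" using le by auto
        then have "guarded U' \<psi>' b' (\<psi>' w) x"
          using phase_keep[OF ph _ w(2) x(3,2) sU] True x(1) by blast
        from guard1[OF True x(1) this] show ?thesis using True w(3) by (simp add: \<phi>'_def)
      next
        case False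
        have "x \<in> comp U w" by (rule walk_component[OF x(3) sU])
        then have "comp U x = comp U u" using component_eq[OF sym_E] ball_component[OF u(1) w(1)]
          by metis
        moreover have "comp U x = comp U v" using component_eq[OF sym_E] ball_component[OF v x(1)]
          by metis
        ultimately have "x \<in> comp U u" "x \<in> comp U v" using component_refl by metis+
        moreover have "x \<in> U" using x(1) v by blast
        ultimately show ?thesis using phase_meet[OF ph _ chi(1)] label u v False by blast
      qed
    qed
    have "\<forall>v. v \<notin> U \<longrightarrow> \<chi> v = \<psi> v" using chi(1) sub by auto
    moreover have "\<forall>u. ball u \<subseteq> U \<longrightarrow> \<phi>' u \<in> \<chi> ` ball u"
    proof (intro allI impI)
      fix u assume "ball u \<subseteq> U"
      show "\<phi>' u \<in> \<chi> ` ball u"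
      proof (cases "ball u \<subseteq> U'")
        case True
        then show ?thesis using in1 by (simp add: \<phi>'_def)
      next
        case False
        then show ?thesis using new[OF \<open>ball u \<subseteq> U\<close>] chi(1) by force
      qed
    qed
    moreover have "\<forall>u v. ball u \<subseteq> U \<longrightarrow> ball v \<subseteq> U \<longrightarrow> near E L u v \<longrightarrow> meet \<chi> (\<phi>' u) (\<phi>' v)"
    proof (intro allI impI)
      fix u v assume uv: "ball u \<subseteq> U" "ball v \<subseteq> U" "near E L u v"
      show "meet \<chi> (\<phi>' u) (\<phi>' v)"
      proof (cases "ball u \<subseteq> U' \<and> ball v \<subseteq> U'")
        case True
        then show ?thesis using near1 uv(3) by (simp add: \<phi>'_def)
      next
        case False
        then show ?thesis using cross[of u v] cross[of v u] uv near_sym[OF sym_E uv(3)] meet_sym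
          by blast
      qed
    qed
    moreover have "\<forall>a v. ball v \<subseteq> U \<longrightarrow> (\<exists>x\<in>ball v. guarded U \<psi> b a x) \<longrightarrow> meet \<chi> a (\<phi>' v)"
    proof (intro allI impI, elim bexE)
      fix a v x assume v: "ball v \<subseteq> U" and x: "x \<in> ball v" "guarded U \<psi> b a x"
      show "meet \<chi> a (\<phi>' v)"
      proof (cases "ball v \<subseteq> U'")
        case True
        then show ?thesis using guard1[OF True x(1) phase_guarded[OF ph _ x(2)]] x(1)
          by (auto simp: \<phi>'_def)
      next
        case False
        have xU: "x \<in> U" using x v by blast
        have "a \<in> seen U \<psi> x" by (rule guarded_seen[OF less.prems(2) xU x(2)])
        then show ?thesis
          using phase_meet[OF ph xU chi(1)] label[OF v False ball_component[OF v x(1)]] by blast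
      qed
    qed
    ultimately show ?thesis using chi(2) by blast
  qed
qed

text \<open>Initially nothing is labelled: rims are empty, and any bag containing \<open>x\<close>
  is a hub. At the end, two vertices with equal \<open>\<phi>\<close> have in their balls vertices
  of a common class.\<close>

lemma ex_partition:
  "\<exists>(\<chi> :: 'a \<Rightarrow> nat) \<phi>. (\<forall>n. conn E {v \<in> V. \<chi> v = n}) \<and> (\<forall>u\<in>V. \<phi> u \<in> \<chi> ` V) \<and>
    (\<forall>u\<in>V. \<forall>v\<in>V. \<phi> u = \<phi> v \<longrightarrow> near E (2 * (k + 1) * L) u v) \<and>
    (\<forall>u\<in>V. \<forall>v\<in>V. near E L u v \<longrightarrow> (\<exists>t\<in>N. \<phi> u \<in> \<chi> ` B t \<and> \<phi> v \<in> \<chi> ` B t))"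
proof -
  have ball: "ball u \<subseteq> V" if "u \<in> V" for u
  proof
    fix w assume "w \<in> ball u"
    then obtain i where "(u, w) \<in> E ^^ i" unfolding near_def by blast
    then show "w \<in> V" using that E_subset by (cases i) auto
  qed
  have rim: "rim V x = {}" for x by (simp add: rim_def)
  have "\<exists>t. hub V (\<lambda>_. 0) x t \<and> B t \<inter> comp V x \<noteq> {}" if x: "x \<in> V" for x
  proof -
    obtain t where "t \<in> N" "x \<in> B t" using vertex_bag[OF x] by blast
    then show ?thesis
      using component_refl[of x E V] by (intro exI[of _ t]) (auto simp: hub_def seen_def rim)
  qed
  then have "valid V (\<lambda>_. 0) (\<lambda>_. 0)" by (simp add: valid_def rim conn_def)
  moreover have "saturated V (\<lambda>_. 0) (\<lambda>_. 0)" by (simp add: saturated_def rim)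
  ultimately obtain \<chi> d \<phi> where chi: "valid {} \<chi> d"
    and img: "\<And>u. ball u \<subseteq> V \<Longrightarrow> \<phi> u \<in> \<chi> ` ball u"
    and nr: "\<And>u v. ball u \<subseteq> V \<Longrightarrow> ball v \<subseteq> V \<Longrightarrow> near E L u v \<Longrightarrow> meet \<chi> (\<phi> u) (\<phi> v)"
    using ex_labelling by metis
  have "near E (2 * (k + 1) * L) u v" if uv: "u \<in> V" "v \<in> V" "\<phi> u = \<phi> v" for u v
  proof -
    obtain w z where w: "w \<in> ball u" "\<phi> u = \<chi> w" and z: "z \<in> ball v" "\<phi> v = \<chi> z"
      using img ball uv by blast
    have wz: "w \<in> V" "z \<in> V" using w z ball uv by auto
    then have "near E (d w + d z) w z" "d w \<le> k * L" "d z \<le> k * L"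
      using chi w z uv(3) by (auto simp: valid_def)
    then have "near E (2 * (k * L)) w z" by (elim near_mono) auto
    moreover have "near E (L div 2) z v" using z(1) near_sym[OF sym_E] by blast
    ultimately have "near E (L div 2 + (2 * (k * L) + L div 2)) u v"
      using w(1) by (blast intro: near_trans)
    \<comment> \<open>The two half-balls cost at most \<open>L\<close> together, so
      \<open>2 * k * L + L\<close> would already do.\<close>
    moreover have "L div 2 + (2 * (k * L) + L div 2) \<le> 2 * (k + 1) * L" by (simp add: algebra_simps)
    ultimately show ?thesis by (rule near_mono)
  qed
  moreover have "\<forall>u\<in>V. \<phi> u \<in> \<chi> ` V" using img ball by blast
  moreover have "\<forall>n. conn E {v \<in> V. \<chi> v = n}" using chi by (simp add: valid_def)
  moreover have "\<forall>u\<in>V. \<forall>v\<in>V. near E L u v \<longrightarrow> (\<exists>t\<in>N. \<phi> u \<in> \<chi> ` B t \<and> \<phi> v \<in> \<chi> ` B t)"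
    using nr ball unfolding meet_def by simp
  ultimately show ?thesis by (intro exI[of _ \<chi>] exI[of _ \<phi>]) simp
qed

end

subsection \<open>Index trees and index paths\<close>

lemma connected_restrict_iff:
  assumes "sym (parcs T)"
  shows "connected (with_proj T \<restriction> X) \<longleftrightarrow> X \<noteq> {} \<and> conn (parcs T) X"
proof -
  have arcs: "parcs (mk_symmetric (with_proj T \<restriction> X)) = parcs T \<inter> X \<times> X"
    using assms by (auto simp: mk_symmetric_def induce_subgraph_def dest: symD)
  have verts: "pverts (mk_symmetric (with_proj T \<restriction> X)) = X"
    by (simp add: mk_symmetric_def induce_subgraph_def)
  have "(u, v) \<in> rtrancl_on X (parcs T \<inter> X \<times> X) \<longleftrightarrow> (u, v) \<in> (parcs T \<inter> X \<times> X)\<^sup>*"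
    if "u \<in> X" "v \<in> X" for u v
    using that rtrancl_on_rtranclI rtrancl_consistent_rtrancl_on[of u v _ X] by (metis IntE SigmaE2)
  then show ?thesis
    by (auto simp: connected_def strongly_connected_def reachable_def arcs verts conn_def)
qed

lemma connected_iff:
  assumes "pair_graph T"
  shows "connected (with_proj T) \<longleftrightarrow> pverts T \<noteq> {} \<and> conn (parcs T) (pverts T)"
proof -
  interpret pair_graph T by fact
  have "sym (parcs T)" using arcs_symmetric by (auto intro: symI)
  moreover have "with_proj T \<restriction> pverts T = with_proj T"
    by (auto simp: induce_subgraph_def with_proj_def dest: in_arcsD1 in_arcsD2)
  ultimately show ?thesis using connected_restrict_iff[of T "pverts T"] by simp
qed

lemma (in pair_wf_digraph) awalk_of_rtrancl:
  assumes "(u, v) \<in> R\<^sup>*" "R \<subseteq> parcs G" "u \<in> pverts G"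
  shows "\<exists>p. awalk u p v \<and> set p \<subseteq> R"
  using assms(1)
proof (induction rule: rtrancl_induct)
  case base
  show ?case using assms(3) by (intro exI[of _ "[]"]) (simp add: awalk_Nil_iff)
next
  case (step y z)
  then obtain p where p: "awalk u p y" "set p \<subseteq> R" by blast
  have "awalk y [(y, z)] z" using step.hyps(2) assms(2)
    by (auto simp: awalk_simps intro: wellformed')
  then have "awalk u (p @ [(y, z)]) z" using p(1) by (rule awalk_appendI[rotated])
  then show ?case using p(2) step.hyps(2) by (intro exI[of _ "p @ [(y, z)]"]) simp
qed

text \<open>Shortening the walk to a path makes its vertices distinct, and \<open>g\<close> closes
  it. The condition \<open>h \<noteq> s\<close> excludes going along an edge and back.\<close>

lemma (in pair_graph) cycle_through:
  assumes "(h, s) \<in> (parcs G \<inter> (- {g}) \<times> (- {g}))\<^sup>*" "h \<noteq> s" "(g, h) \<in> parcs G" "(s, g) \<in> parcs G"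
  shows "\<exists>c. cycle c \<and> 3 \<le> length c"
proof -
  let ?R = "parcs G \<inter> (- {g}) \<times> (- {g})"
  have verts: "h \<in> pverts G" "g \<in> pverts G" using assms(3) wellformed' by auto
  obtain p where p: "awalk h p s" "set p \<subseteq> ?R" using awalk_of_rtrancl[OF assms(1)] verts by auto
  define q where "q = awalk_to_apath p"
  have q: "apath h q s" "set q \<subseteq> ?R"
    unfolding q_def using apath_awalk_to_apath[OF p(1)] awalk_to_apath_subset[OF p(1)] p(2) by auto
  then have aw: "awalk h q s" "distinct (awalk_verts h q)" by (auto simp: apath_def)
  have "q \<noteq> []" using aw(1) assms(2) by (auto simp: awalk_Nil_iff)
  then have "last q \<in> ?R" using q(2) last_in_set by blast
  then have g: "g \<notin> set (awalk_verts h q)" using q(2) \<open>q \<noteq> []\<close> by (auto simp: awalk_verts_conv)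
  let ?c = "(g, h) # q @ [(s, g)]"
  have sg: "awalk s [(s, g)] g" using assms(4) by (auto simp: awalk_simps intro: wellformed')
  have qsg: "awalk h (q @ [(s, g)]) g" by (rule awalk_appendI[OF aw(1) sg])
  then have "awalk g ?c g" using assms(3) by (simp add: awalk_Cons_iff del: awalk_append_iff)
  moreover have "awalk_verts h (q @ [(s, g)]) = awalk_verts h q @ [g]"
    using awalk_verts_append[OF qsg] by simp
  then have "distinct (tl (awalk_verts g ?c))" using aw(2) g by simp
  ultimately have "cycle ?c" unfolding cycle_def by blast
  moreover have "3 \<le> length ?c" using \<open>q \<noteq> []\<close> by (cases q) auto
  ultimately show ?thesis by blast
qed

text \<open>\<open>g\<close> is where a walk first enters \<open>S\<close>, and \<open>h\<close> is
  the vertex just before.\<close>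

lemma rtrancl_first_entry:
  assumes "(t, s) \<in> R\<^sup>*" "t \<notin> S" "s \<in> S"
  shows "\<exists>h g. (t, h) \<in> (R \<inter> (- S) \<times> (- S))\<^sup>* \<and> (h, g) \<in> R \<and> h \<notin> S \<and> g \<in> S"
  using assms(1,3)
proof (induction rule: rtrancl_induct)
  case (step y z)
  show ?case
  proof (cases "y \<in> S")
    case False
    have "(t, w) \<in> (R \<inter> (- S) \<times> (- S))\<^sup>* \<or>
        (\<exists>h g. (t, h) \<in> (R \<inter> (- S) \<times> (- S))\<^sup>* \<and> (h, g) \<in> R \<and> h \<notin> S \<and> g \<in> S)"
      if "(t, w) \<in> R\<^sup>*" for w using that
    proof (induction rule: rtrancl_induct)
      case (step y z)
      have "y \<notin> S" if "(t, y) \<in> (R \<inter> (- S) \<times> (- S))\<^sup>*"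
        using that assms(2) by (auto elim: rtranclE)
      then show ?case using step
        by (metis ComplI IntI SigmaI rtrancl.rtrancl_into_rtrancl)
    qed auto
    from this[OF step.hyps(1)] show ?thesis using step False by blast
  qed (use step in blast)
qed (use assms(2) in simp)

text \<open>The gate is the first vertex \<open>g\<close> of \<open>S\<close> on a walk from
  \<open>t\<close>. A connected set joining \<open>t\<close> to \<open>S\<close> without
  \<open>g\<close> would lead from \<open>h\<close>, through \<open>t\<close> and that set, into
  \<open>S\<close> and on to another neighbour of \<open>g\<close>: a cycle.\<close>

lemma tree_graph_gated:
  assumes "tree_graph T"
  shows "gated (pverts T) (parcs T)"
  unfolding gated_def
proof (intro allI impI)
  fix S t assume S: "S \<subseteq> pverts T" "S \<noteq> {}" "conn (parcs T) S" and t: "t \<in> pverts T"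
  let ?F = "parcs T"
  have pg: "pair_graph T" using assms by (simp add: tree_graph_def)
  interpret pair_graph T by (rule pg)
  have sym: "sym ?F" using arcs_symmetric by (auto intro: symI)
  have acyclic: "\<not> (\<exists>c. cycle c \<and> 3 \<le> length c)" using assms by (simp add: tree_graph_def)
  have cn: "conn ?F (pverts T)" using assms connected_iff[OF pg] by (simp add: tree_graph_def)
  show "\<exists>g\<in>S. \<forall>C. C \<subseteq> pverts T \<longrightarrow> conn ?F C \<longrightarrow> t \<in> C \<longrightarrow> C \<inter> S \<noteq> {} \<longrightarrow> g \<in> C"
  proof (cases "t \<in> S")
    case False
    obtain s0 where s0: "s0 \<in> S" using S(2) by blast
    then have "(t, s0) \<in> (?F \<inter> pverts T \<times> pverts T)\<^sup>*" using cn t S(1) unfolding conn_def by blast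
    then have "(t, s0) \<in> ?F\<^sup>*" by (rule rtrancl_mono[THEN subsetD, rotated]) auto
    from rtrancl_first_entry[OF this False s0] obtain h g where
      hg: "(t, h) \<in> (?F \<inter> (- S) \<times> (- S))\<^sup>*" "(h, g) \<in> ?F" "h \<notin> S" "g \<in> S" by blast
    have "g \<in> C" if C: "C \<subseteq> pverts T" "conn ?F C" "t \<in> C" "C \<inter> S \<noteq> {}" for C
    proof (rule ccontr)
      assume g: "g \<notin> C"
      obtain s where s: "s \<in> C" "s \<in> S" using C(4) by blast
      let ?R = "?F \<inter> (- {g}) \<times> (- {g})"
      have "(h, t) \<in> (?F \<inter> (- S) \<times> (- S))\<^sup>*"
        using hg(1) sym_rtrancl[OF sym_restrict[OF sym]] by (meson symD)
      then have ht: "(h, t) \<in> ?R\<^sup>*" by (rule conn_rtrancl_mono) (use hg(4) in auto)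
      have "(t, s) \<in> (?F \<inter> C \<times> C)\<^sup>*" using C s unfolding conn_def by blast
      then have ts: "(t, s) \<in> ?R\<^sup>*" by (rule conn_rtrancl_mono) (use g in auto)
      have "(s, g) \<in> (?F \<inter> S \<times> S)\<^sup>*" using S(3) s(2) hg(4) unfolding conn_def by blast
      moreover have "s \<notin> {g}" using s(1) g by auto
      ultimately obtain s' where s': "(s, s') \<in> (?F \<inter> S \<times> S \<inter> (- {g}) \<times> (- {g}))\<^sup>*"
        "(s', g) \<in> ?F \<inter> S \<times> S" "s' \<notin> {g}" using rtrancl_first_entry[of s g "?F \<inter> S \<times> S" "{g}"]
          by blast
      have "(s, s') \<in> ?R\<^sup>*" using s'(1) by (rule rtrancl_mono[THEN subsetD, rotated]) auto
      then have "(h, s') \<in> ?R\<^sup>*" using ht ts by (meson rtrancl_trans)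
      moreover have "h \<noteq> s'" using hg(3) s'(2) by auto
      moreover have "(g, h) \<in> ?F" "(s', g) \<in> ?F" using hg(2) s'(2) arcs_symmetric by auto
      ultimately show False using cycle_through acyclic by blast
    qed
    then show ?thesis using hg(4) by blast
  qed blast
qed

lemma vwalk_arcs_nth:
  "(x, y) \<in> set (vwalk_arcs ts) \<longleftrightarrow> (\<exists>i. Suc i < length ts \<and> x = ts ! i \<and> y = ts ! Suc i)"
proof (induction ts rule: vwalk_arcs.induct)
  case (3 a b ts)
  show ?case
  proof
    assume "(x, y) \<in> set (vwalk_arcs (a # b # ts))"
    then consider "x = a" "y = b" | "(x, y) \<in> set (vwalk_arcs (b # ts))" by auto
    then show "\<exists>i. Suc i < length (a # b # ts) \<and> x = (a # b # ts) ! i \<and> y = (a # b # ts) ! Suc i"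
    proof cases
      case 1 then show ?thesis by (intro exI[of _ 0]) auto
    next
      case 2
      then obtain i where "Suc i < length (b # ts) \<and> x = (b # ts) ! i \<and> y = (b # ts) ! Suc i"
        using 3 by blast
      then show ?thesis by (intro exI[of _ "Suc i"]) auto
    qed
  next
    assume "\<exists>i. Suc i < length (a # b # ts) \<and> x = (a # b # ts) ! i \<and> y = (a # b # ts) ! Suc i"
    then obtain i
      where i: "Suc i < length (a # b # ts)" "x = (a # b # ts) ! i" "y = (a # b # ts) ! Suc i"
      by blast
    then show "(x, y) \<in> set (vwalk_arcs (a # b # ts))"
      using 3 by (cases i) auto
  qed
qed auto

text \<open>Each step changes the index by one, so a walk that avoids index \<open>m\<close> stays
  below it.\<close>

lemma path_convex:
  assumes "distinct ts" "F = set (vwalk_arcs ts) \<union> (set (vwalk_arcs ts))\<inverse>"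
    and "conn F C" "ts ! i \<in> C" "ts ! j \<in> C" "i \<le> m" "m \<le> j" "j < length ts"
  shows "ts ! m \<in> C"
proof (rule ccontr)
  assume m: "ts ! m \<notin> C"
  have im: "i < m" using m assms(4,6) by (cases "i = m") auto
  have "(ts ! i, ts ! j) \<in> (F \<inter> C \<times> C)\<^sup>*" using assms(3-5) unfolding conn_def by blast
  then have "\<exists>l<m. ts ! j = ts ! l"
  proof (induction rule: rtrancl_induct)
    case base
    show ?case using im by blast
  next
    case (step y z)
    then obtain l where l: "l < m" "y = ts ! l" by blast
    have "(y, z) \<in> set (vwalk_arcs ts) \<or> (z, y) \<in> set (vwalk_arcs ts)" using step.hyps(2) assms(2)
      by auto
    then show ?case
    proof
      assume "(y, z) \<in> set (vwalk_arcs ts)"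
      then obtain e where e: "Suc e < length ts" "y = ts ! e" "z = ts ! Suc e"
        by (auto simp: vwalk_arcs_nth)
      then have "e = l" using l assms(1,7,8) nth_eq_iff_index_eq[of ts e l] by auto
      then have "Suc l \<noteq> m" using e m step.hyps(2) by auto
      then show ?thesis using e \<open>e = l\<close> l by (intro exI[of _ "Suc l"]) auto
    next
      assume "(z, y) \<in> set (vwalk_arcs ts)"
      then obtain e where e: "Suc e < length ts" "z = ts ! e" "y = ts ! Suc e"
        by (auto simp: vwalk_arcs_nth)
      then have "Suc e = l" using l assms(1,7,8) nth_eq_iff_index_eq[of ts "Suc e" l] by auto
      then show ?thesis using e l by (intro exI[of _ e]) auto
    qed
  qed
  then obtain l where "l < m" "ts ! j = ts ! l" by blast
  then show False using assms(1,7,8) nth_eq_iff_index_eq[of ts j l] by auto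
qed

text \<open>The gate has the largest index of \<open>S\<close> up to that of \<open>t\<close>, or
  the smallest index of \<open>S\<close> if all lie beyond \<open>t\<close>.\<close>

lemma path_graph_gated:
  assumes "path_graph T"
  shows "gated (pverts T) (parcs T)"
  unfolding gated_def
proof (intro allI impI)
  fix S t assume S: "S \<subseteq> pverts T" "S \<noteq> {}" "conn (parcs T) S" and t: "t \<in> pverts T"
  obtain ts where ts: "distinct ts" "pverts T = set ts"
    "parcs T = set (vwalk_arcs ts) \<union> (set (vwalk_arcs ts))\<inverse>"
    using assms unfolding path_graph_def by blast
  note convex = path_convex[OF ts(1,3)]
  obtain \<tau> where \<tau>: "\<tau> < length ts" "t = ts ! \<tau>" using t ts(2) by (metis in_set_conv_nth)
  define I where "I = {i. i < length ts \<and> ts ! i \<in> S}"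
  have fin: "finite I" and ne: "I \<noteq> {}"
    using S(1,2) ts(2) unfolding I_def by (auto simp: subset_iff in_set_conv_nth)
  have idx: "\<exists>j\<in>I. ts ! j \<in> C" if "C \<inter> S \<noteq> {}" for C
    using that S(1) ts(2) unfolding I_def by (auto simp: subset_iff in_set_conv_nth)
  show "\<exists>g\<in>S. \<forall>C. C \<subseteq> pverts T \<longrightarrow> conn (parcs T) C \<longrightarrow> t \<in> C \<longrightarrow> C \<inter> S \<noteq> {} \<longrightarrow> g \<in> C"
  proof (cases "\<exists>i\<in>I. i \<le> \<tau>")
    case True
    define m where "m = Max {i \<in> I. i \<le> \<tau>}"
    have fin': "finite {i \<in> I. i \<le> \<tau>}" using fin by simp
    have "m \<in> {i \<in> I. i \<le> \<tau>}" unfolding m_def using True by (intro Max_in fin') blast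
    then have m: "m \<in> I" "m \<le> \<tau>" by simp_all
    have m_ge: "i \<le> m" if "i \<in> I" "i \<le> \<tau>" for i
      unfolding m_def using that by (intro Max_ge fin') simp
    have "ts ! m \<in> C" if C: "conn (parcs T) C" "t \<in> C" "C \<inter> S \<noteq> {}" for C
    proof -
      obtain j where j: "j \<in> I" "ts ! j \<in> C" using idx C(3) by blast
      show ?thesis
      proof (cases "j \<le> \<tau>")
        case True
        then show ?thesis using convex[OF C(1) j(2), of \<tau> m] C(2) \<tau> m m_ge[OF j(1)] j(1) by auto
      next
        case False
        \<comment> \<open>With indices of \<open>S\<close> on both sides, convexity puts
          \<open>t\<close> itself into \<open>S\<close>, and \<open>t\<close> is its own
          gate.\<close>
        then have "ts ! \<tau> \<in> S" using convex[OF S(3), of m j \<tau>] m j unfolding I_def by auto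
        then have "m = \<tau>" using m(2) m_ge[of \<tau>] \<tau>(1) unfolding I_def by auto
        then show ?thesis using C(2) \<tau> by simp
      qed
    qed
    then show ?thesis using m(1) unfolding I_def by blast
  next
    case False
    define m where "m = Min I"
    have m: "m \<in> I" "\<And>i. i \<in> I \<Longrightarrow> m \<le> i" using Min_in[OF fin ne] Min_le[OF fin] unfolding m_def
      by auto
    have "ts ! m \<in> C" if C: "conn (parcs T) C" "t \<in> C" "C \<inter> S \<noteq> {}" for C
    proof -
      obtain j where j: "j \<in> I" "ts ! j \<in> C" using idx C(3) by blast
      then show ?thesis using convex[OF C(1), of \<tau> j m] C(2) \<tau> m False unfolding I_def by auto
    qed
    then show ?thesis using m(1) unfolding I_def by blast
  qed
qed

subsection \<open>The quotient graph\<close>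

lemma (in pair_wf_digraph) awalk_relpow:
  assumes "u \<in> pverts G"
  shows "(\<exists>p. awalk u p v \<and> length p = n) \<longleftrightarrow> (u, v) \<in> parcs G ^^ n"
  using assms
proof (induction n arbitrary: u)
  case 0
  then show ?case by (auto simp: awalk_Nil_iff)
next
  case (Suc n)
  show ?case
  proof
    assume "\<exists>p. awalk u p v \<and> length p = Suc n"
    then obtain e q where p: "awalk u (e # q) v" "length q = n" by (metis length_Suc_conv)
    then have e: "e \<in> parcs G" "u = fst e" "awalk (snd e) q v" by (auto simp: awalk_Cons_iff)
    then have "(snd e, v) \<in> parcs G ^^ n" using Suc.IH[of "snd e"] p(2)
      by (auto dest: arc_snd_in_verts)
    moreover have "(u, snd e) \<in> parcs G" using e(1,2) by simp
    ultimately show "(u, v) \<in> parcs G ^^ Suc n" by (rule relpow_Suc_I2[rotated])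
  next
    assume "(u, v) \<in> parcs G ^^ Suc n"
    then obtain w where w: "(u, w) \<in> parcs G" "(w, v) \<in> parcs G ^^ n" by (meson relpow_Suc_D2)
    then obtain q where "awalk w q v" "length q = n" using Suc.IH[of w] wellformed' by blast
    then show "\<exists>p. awalk u p v \<and> length p = Suc n"
      using w(1) wellformed' by (intro exI[of _ "(u, w) # q"]) (auto simp: awalk_Cons_iff)
  qed
qed

lemma (in pair_wf_digraph) awalk_cost_one: "awalk_cost (\<lambda>_. 1) p = real (length p)"
  by (induction p) auto

lemma (in pair_wf_digraph) graph_dist_le:
  assumes "near (parcs G) n u v" "u \<in> pverts G"
  shows "graph_dist G u v \<le> ereal (real n)"
proof -
  obtain m where "(u, v) \<in> parcs G ^^ m" "m \<le> n" using assms(1) unfolding near_def by blast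
  then obtain p where "awalk u p v" "length p \<le> n" using awalk_relpow[OF assms(2)] by metis
  then have "graph_dist G u v \<le> ereal (real (length p))" "length p \<le> n"
    using min_cost_le_walk_cost[of u p v "\<lambda>_. 1"] by (auto simp: graph_dist_def awalk_cost_one)
  then show ?thesis by (meson ereal_less_eq(3) of_nat_le_iff order_trans)
qed

text \<open>Walk lengths are integers. The strict bound extracts a walk from the infimum without
  showing that it is attained.\<close>

lemma (in pair_wf_digraph) near_if_graph_dist_less:
  assumes "graph_dist G u v < ereal (real n + 1)"
  shows "near (parcs G) n u v"
proof -
  obtain p where p: "awalk u p v" "ereal (awalk_cost (\<lambda>_. 1) p) < ereal (real n + 1)"
    using assms unfolding graph_dist_def \<mu>_def by (auto simp: INF_less_iff)
  then have "length p \<le> n" by (simp add: awalk_cost_one)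
  moreover have "u \<in> pverts G" using p(1) awalk_hd_in_verts by blast
  ultimately show ?thesis using p(1) awalk_relpow[of u v "length p"] unfolding near_def by metis
qed

lemma (in pair_wf_digraph) near_if_set_graph_dist_le:
  assumes "set_graph_dist G S S' \<le> ereal l" "0 \<le> l"
  shows "\<exists>u\<in>S. \<exists>v\<in>S'. near (parcs G) (nat \<lfloor>l\<rfloor>) u v"
proof -
  have "l < real (nat \<lfloor>l\<rfloor>) + 1" using assms(2) by linarith
  then have "set_graph_dist G S S' < ereal (real (nat \<lfloor>l\<rfloor>) + 1)"
    using assms(1) by (meson ereal_less(2) less_ereal.simps(1) order_le_less_trans)
  then show ?thesis unfolding set_graph_dist_def INF_less_iff using near_if_graph_dist_less by blast
qed

text \<open>The index graph \<open>T\<close> is kept and only the bags are mapped to labels, so the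
  kind of decomposition is inherited and bags do not grow.\<close>

lemma ex_compressing_quotient:
  fixes H :: "'a pair_pre_digraph"
  assumes H: "pair_graph H" and G: "graph_decomposition H T B"
    and T: "finite (pverts T)" "pverts T \<noteq> {}" "sym (parcs T)" "gated (pverts T) (parcs T)"
    and w: "decomposition_width T B \<le> k" and l: "0 \<le> l"
  shows "\<exists>(A :: 'a pair_pre_digraph) W P. pair_graph A \<and> graph_decomposition A T W \<and>
    decomposition_width T W \<le> k \<and>
    indexed_partition A H P \<and> compressing l A H P \<and>
    (\<forall>a\<in>pverts A. weak_diameter H (P a) \<le> ereal (2 * (real k + 1) * l))"
proof -
  interpret H: pair_graph H by fact
  let ?V = "pverts H" and ?E = "parcs H" and ?N = "pverts T" and ?F = "parcs T"
  define L where "L = nat \<lfloor>l\<rfloor>"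
  have bag: "B t \<subseteq> ?V" if "t \<in> ?N" for t using G that by (auto simp: graph_decomposition_def)
  have card: "card (B t) \<le> Suc k" if "t \<in> ?N" for t
  proof -
    have "card (B t) \<le> Max ((\<lambda>t. card (B t)) ` ?N)" using T(1) that by (intro Max_ge) auto
    then show ?thesis using w by (simp add: decomposition_width_def)
  qed
  have trees: "{t \<in> ?N. v \<in> B t} \<noteq> {}" "conn ?F {t \<in> ?N. v \<in> B t}" if "v \<in> ?V" for v
    using G that unfolding graph_decomposition_def connected_restrict_iff[OF T(3)] by blast+
  interpret D: decomposed_graph ?V ?E ?N ?F B k L
  proof
    show "finite ?V" by (rule H.pair_finite_verts)
    show "?E \<subseteq> ?V \<times> ?V" using H.in_arcsD1 H.in_arcsD2 by auto
    show "sym ?E" using H.arcs_symmetric by (auto intro: symI)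
    show "gated ?N ?F" by (rule T(4))
    show "\<exists>t\<in>?N. u \<in> B t \<and> v \<in> B t" if "(u, v) \<in> ?E" for u v
      using G that by (auto simp: graph_decomposition_def)
    show "\<exists>t\<in>?N. v \<in> B t" if "v \<in> ?V" for v using trees(1)[OF that] by auto
  qed (use bag card trees in auto)
  obtain \<chi> :: "'a \<Rightarrow> nat" and \<phi> where part: "\<forall>n. conn ?E {v \<in> ?V. \<chi> v = n}" "\<forall>u\<in>?V. \<phi> u \<in> \<chi> ` ?V"
    "\<forall>u\<in>?V. \<forall>v\<in>?V. \<phi> u = \<phi> v \<longrightarrow> near ?E (2 * (k + 1) * L) u v"
    "\<forall>u\<in>?V. \<forall>v\<in>?V. near ?E L u v \<longrightarrow> (\<exists>t\<in>?N. \<phi> u \<in> \<chi> ` B t \<and> \<phi> v \<in> \<chi> ` B t)"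
    using D.ex_partition by (elim exE conjE)
  note classes = part(1)[rule_format] and img = part(2)[rule_format]
    and diam = part(3)[rule_format] and close = part(4)[rule_format]
  \<comment> \<open>A vertex of each class stands for its label, which gives \<open>A\<close> the
    vertex type of \<open>H\<close>.\<close>
  define rep where "rep n = (SOME v. v \<in> ?V \<and> \<chi> v = n)" for n
  have rep: "rep n \<in> ?V" "\<chi> (rep n) = n" if "n \<in> \<chi> ` ?V" for n
  proof -
    have "\<exists>v. v \<in> ?V \<and> \<chi> v = n" using that by auto
    from someI_ex[OF this] show "rep n \<in> ?V" "\<chi> (rep n) = n" unfolding rep_def by simp_all
  qed
  define W where "W t = (rep \<circ> \<chi>) ` B t" for t
  \<comment> \<open>Joining all pairs with a common bag is the most that \<open>W\<close> permits,
    so compression reduces to finding a common bag.\<close>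
  define A where "A = \<lparr>pverts = (rep \<circ> \<chi>) ` ?V,
    parcs = {(a, b). a \<noteq> b \<and> (\<exists>t\<in>?N. a \<in> W t \<and> b \<in> W t)}\<rparr>"
  \<comment> \<open>Parts come from \<open>\<phi>\<close>, but bags come from \<open>\<chi>\<close>,
    whose classes are known to be connected.\<close>
  define P where "P a = {u \<in> ?V. rep (\<phi> u) = a}" for a
  have WA: "W t \<subseteq> pverts A" if "t \<in> ?N" for t
    unfolding W_def A_def pair_pre_digraph.simps by (rule image_mono[OF bag[OF that]])
  have finA: "finite (pverts A)" by (simp add: A_def H.pair_finite_verts)
  have arc_iff: "(a, b) \<in> parcs A \<longleftrightarrow> a \<noteq> b \<and> (\<exists>t\<in>?N. a \<in> W t \<and> b \<in> W t)" for a b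
    by (simp add: A_def)
  have arcsA: "parcs A \<subseteq> pverts A \<times> pverts A"
  proof (rule subrelI)
    fix a b assume "(a, b) \<in> parcs A"
    then obtain t where "t \<in> ?N" "a \<in> W t" "b \<in> W t" using arc_iff by blast
    then show "(a, b) \<in> pverts A \<times> pverts A" using WA by blast
  qed
  have "pair_graph A"
  proof
    show "finite (pverts A)" by (rule finA)
    show "finite (parcs A)" using arcsA finA by (meson finite_SigmaI finite_subset)
    show "symmetric A" unfolding symmetric_def with_proj_simps by (rule symI) (auto simp: arc_iff)
    show "fst e \<in> pverts A" "snd e \<in> pverts A" if "e \<in> parcs A" for e using arcsA that by auto
    show "fst e \<noteq> snd e" if "e \<in> parcs A" for e
      using that arc_iff[of "fst e" "snd e"] by simp
  qed
  moreover have "graph_decomposition A T W"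
  proof -
    have "connected (with_proj T \<restriction> {t \<in> ?N. a \<in> W t})" if a: "a \<in> pverts A" for a
    proof -
      obtain v where v: "v \<in> ?V" "a = rep (\<chi> v)" using a by (auto simp: A_def)
      let ?M = "{u \<in> ?V. \<chi> u = \<chi> v}"
      \<comment> \<open>The trace of a representative in the new bags is the trace of its class in
        the old ones.\<close>
      have eq: "{t \<in> ?N. a \<in> W t} = {t \<in> ?N. B t \<inter> ?M \<noteq> {}}"
      proof (rule Collect_cong, rule conj_cong[OF refl])
        fix t assume t: "t \<in> ?N"
        show "a \<in> W t \<longleftrightarrow> B t \<inter> ?M \<noteq> {}"
        proof
          assume "a \<in> W t"
          then obtain u where u: "u \<in> B t" "a = rep (\<chi> u)" unfolding W_def comp_def by (elim imageE)
          have "u \<in> ?V" using u(1) bag[OF t] by blast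
          then have "\<chi> u = \<chi> v" using u(2) v rep(2)[OF imageI] by metis
          then show "B t \<inter> ?M \<noteq> {}" using u(1) \<open>u \<in> ?V\<close> by blast
        next
          assume "B t \<inter> ?M \<noteq> {}"
          then obtain u where "u \<in> B t" "\<chi> u = \<chi> v" by blast
          then show "a \<in> W t" using v(2) unfolding W_def by (intro image_eqI[of _ _ u]) simp_all
        qed
      qed
      have "conn ?F {t \<in> ?N. B t \<inter> ?M \<noteq> {}}" using classes by (intro D.conn_bags_Union) blast+
      moreover have "{t \<in> ?N. B t \<inter> ?M \<noteq> {}} \<noteq> {}" using D.vertex_bag[OF v(1)] v(1) by blast
      ultimately show ?thesis unfolding connected_restrict_iff[OF T(3)] eq by blast
    qed
    moreover have "\<exists>t\<in>?N. a \<in> W t \<and> b \<in> W t" if "(a, b) \<in> parcs A" for a b using that arc_iff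
      by blast
    ultimately show ?thesis using WA unfolding graph_decomposition_def by blast
  qed
  moreover have "decomposition_width T W \<le> k"
  proof -
    have "card (W t) \<le> Suc k" if "t \<in> ?N" for t
    proof -
      have "card (W t) \<le> card (B t)" unfolding W_def
        using bag[OF that] H.pair_finite_verts finite_subset by (blast intro: card_image_le)
      then show ?thesis using card[OF that] by linarith
    qed
    then have "Max ((\<lambda>t. card (W t)) ` ?N) \<le> Suc k" using T(1,2) by (subst Max_le_iff) auto
    then show ?thesis by (simp add: decomposition_width_def)
  qed
  moreover have "indexed_partition A H P"
  proof -
    have "(\<Union>a\<in>pverts A. P a) = ?V" using img by (fastforce simp: P_def A_def)
    moreover have "disjoint_family_on P (pverts A)" by (auto simp: disjoint_family_on_def P_def)
    ultimately show ?thesis by (simp add: indexed_partition_def)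
  qed
  moreover have "compressing l A H P"
    unfolding compressing_def
  proof (intro ballI impI)
    fix a a' assume "a \<noteq> a'" "set_graph_dist H (P a) (P a') \<le> ereal l"
    then obtain u v where uv: "u \<in> P a" "v \<in> P a'" "near ?E L u v"
      using H.near_if_set_graph_dist_le l unfolding L_def by blast
    then obtain t where "t \<in> ?N" "\<phi> u \<in> \<chi> ` B t" "\<phi> v \<in> \<chi> ` B t"
      using close[of u v] unfolding P_def by blast
    then have "t \<in> ?N" "a \<in> W t" "a' \<in> W t" using uv(1,2) by (auto simp: W_def P_def)
    then show "(a, a') \<in> parcs A" using \<open>a \<noteq> a'\<close> arc_iff by blast
  qed
  moreover have "weak_diameter H (P a) \<le> ereal (2 * (real k + 1) * l)" for a
    unfolding weak_diameter_def
  proof (intro SUP_least)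
    fix u v assume "u \<in> P a" "v \<in> P a"
    then have uv: "u \<in> ?V" "v \<in> ?V" "rep (\<phi> u) = rep (\<phi> v)" by (auto simp: P_def)
    then have "\<phi> u = \<phi> v" using rep(2)[OF img[OF uv(1)]] rep(2)[OF img[OF uv(2)]] by metis
    from H.graph_dist_le[OF diam[OF uv(1,2) this] uv(1)]
    have "graph_dist H u v \<le> ereal (real (2 * (k + 1) * L))" .
    also have "real (2 * (k + 1) * L) \<le> 2 * (real k + 1) * l"
    proof -
      have "real L \<le> l" using l by (simp add: L_def)
      then have "2 * (real k + 1) * real L \<le> 2 * (real k + 1) * l" by (intro mult_left_mono) auto
      then show ?thesis by (simp add: algebra_simps)
    qed
    finally show "graph_dist H u v \<le> ereal (2 * (real k + 1) * l)" by simp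
  qed
  ultimately show ?thesis by (intro exI[of _ A] exI[of _ W] exI[of _ P] conjI ballI)
qed

section \<open>Decompositions that attain the width\<close>

lemma path_graph_single: "path_graph \<lparr>pverts = {t}, parcs = {}\<rparr>"
  unfolding path_graph_def by (rule exI[of _ "[t]"]) simp

lemma tree_graph_single: "tree_graph \<lparr>pverts = {t}, parcs = {}\<rparr>" (is "tree_graph ?T")
proof -
  have T: "pair_graph ?T" by unfold_locales (auto simp: symmetric_def sym_def)
  then interpret pair_graph ?T .
  have "\<not> cycle p" for p by (auto simp: cycle_def awalk_def)
  then show ?thesis using T connected_iff[OF T] by (auto simp: tree_graph_def conn_def)
qed

text \<open>The trivial decomposition shows that some width exists, so the \<open>LEAST\<close> in
  each width is attained.\<close>

lemma graph_decomposition_single: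
  assumes "pair_graph G"
  shows "graph_decomposition G \<lparr>pverts = {t}, parcs = {}\<rparr> (\<lambda>_. pverts G)"
proof -
  interpret pair_graph G by fact
  have "sym (parcs \<lparr>pverts = {t}, parcs = {}\<rparr>)" by (simp add: sym_def)
  then show ?thesis
    unfolding graph_decomposition_def connected_restrict_iff[OF \<open>sym _\<close>]
    using in_arcsD1 in_arcsD2 by (auto simp: conn_def)
qed

lemma ex_tree_decomposition:
  assumes "pair_graph G" "treewidth G \<le> k"
  shows "\<exists>(T :: nat pair_pre_digraph) B. tree_decomposition G T B \<and> decomposition_width T B \<le> k"
proof -
  have "tree_decomposition G \<lparr>pverts = {0 :: nat}, parcs = {}\<rparr> (\<lambda>_. pverts G)"
    by (simp add: tree_decomposition_def graph_decomposition_single[OF assms(1)] tree_graph_single)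
  then have "\<exists>w (T :: nat pair_pre_digraph) B. tree_decomposition G T B \<and>
    decomposition_width T B = w"
    by (intro exI) (erule conjI[OF _ refl])
  from LeastI_ex[OF this] show ?thesis using assms(2) unfolding treewidth_def by metis
qed

lemma ex_path_decomposition:
  assumes "pair_graph G" "pathwidth G \<le> k"
  shows "\<exists>(T :: nat pair_pre_digraph) B. path_decomposition G T B \<and> decomposition_width T B \<le> k"
proof -
  have "path_decomposition G \<lparr>pverts = {0 :: nat}, parcs = {}\<rparr> (\<lambda>_. pverts G)"
    by (simp add: path_decomposition_def graph_decomposition_single[OF assms(1)] path_graph_single)
  then have "\<exists>w (T :: nat pair_pre_digraph) B. path_decomposition G T B \<and>
    decomposition_width T B = w"
    by (intro exI) (erule conjI[OF _ refl])
  from LeastI_ex[OF this] show ?thesis using assms(2) unfolding pathwidth_def by metis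
qed

lemma treewidth_le:
  fixes T :: "nat pair_pre_digraph"
  assumes "tree_decomposition G T B"
  shows "treewidth G \<le> decomposition_width T B"
  unfolding treewidth_def by (rule Least_le) (use assms in blast)

lemma pathwidth_le:
  fixes T :: "nat pair_pre_digraph"
  assumes "path_decomposition G T B"
  shows "pathwidth G \<le> decomposition_width T B"
  unfolding pathwidth_def by (rule Least_le) (use assms in blast)

theorem theorem7:
  fixes k :: nat
  shows "compressing_function (\<lambda>l. 2 * (real k + 1) * l)
           {G :: 'a pair_pre_digraph. pair_graph G \<and> treewidth G \<le> k} \<and>
         compressing_function (\<lambda>l. 2 * (real k + 1) * l)
           {G :: 'a pair_pre_digraph. pair_graph G \<and> pathwidth G \<le> k}"
proof
  show "compressing_function (\<lambda>l. 2 * (real k + 1) * l)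
    {G :: 'a pair_pre_digraph. pair_graph G \<and> treewidth G \<le> k}"
    unfolding compressing_function_def
  proof (intro conjI allI impI ballI)
    fix l :: real and H :: "'a pair_pre_digraph"
    assume l: "0 \<le> l" and "H \<in> {G. pair_graph G \<and> treewidth G \<le> k}"
    then have H: "pair_graph H" "treewidth H \<le> k" by auto
    obtain T :: "nat pair_pre_digraph" and B where
      T: "tree_graph T" "graph_decomposition H T B" "decomposition_width T B \<le> k"
      using ex_tree_decomposition[OF H] unfolding tree_decomposition_def by blast
    then have pg: "pair_graph T" by (simp add: tree_graph_def)
    then interpret T: pair_graph T .
    have ne: "pverts T \<noteq> {}" using T(1) connected_iff[OF pg] by (simp add: tree_graph_def)
    have sm: "sym (parcs T)" using T.arcs_symmetric by (auto intro: symI)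
    obtain A :: "'a pair_pre_digraph" and W P
      where A: "pair_graph A" "graph_decomposition A T W" "decomposition_width T W \<le> k"
      and P: "indexed_partition A H P" "compressing l A H P"
        "\<forall>a\<in>pverts A. weak_diameter H (P a) \<le> ereal (2 * (real k + 1) * l)"
      using ex_compressing_quotient[OF H(1) T(2) T.pair_finite_verts ne sm tree_graph_gated[OF T(1)] T(3) l] by blast
    have "tree_decomposition A T W" using T(1) A(2) by (simp add: tree_decomposition_def)
    then have "treewidth A \<le> k" using treewidth_le A(3) order_trans by blast
    then show "\<exists>A\<in>{G :: 'a pair_pre_digraph. pair_graph G \<and> treewidth G \<le> k}.
        \<exists>P. indexed_partition A H P \<and>
        compressing l A H P \<and> (\<forall>a\<in>pverts A. weak_diameter H (P a) \<le> ereal (2 * (real k + 1) * l))"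
      using A(1) P by blast
  qed auto
  show "compressing_function (\<lambda>l. 2 * (real k + 1) * l)
    {G :: 'a pair_pre_digraph. pair_graph G \<and> pathwidth G \<le> k}"
    unfolding compressing_function_def
  proof (intro conjI allI impI ballI)
    fix l :: real and H :: "'a pair_pre_digraph"
    assume l: "0 \<le> l" and "H \<in> {G. pair_graph G \<and> pathwidth G \<le> k}"
    then have H: "pair_graph H" "pathwidth H \<le> k" by auto
    obtain T :: "nat pair_pre_digraph" and B where
      T: "path_graph T" "graph_decomposition H T B" "decomposition_width T B \<le> k"
      using ex_path_decomposition[OF H] unfolding path_decomposition_def by blast
    have ne: "pverts T \<noteq> {}" "finite (pverts T)" "sym (parcs T)"
      using T(1) by (auto simp: path_graph_def sym_def)
    obtain A :: "'a pair_pre_digraph" and W P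
      where A: "pair_graph A" "graph_decomposition A T W" "decomposition_width T W \<le> k"
      and P: "indexed_partition A H P" "compressing l A H P"
        "\<forall>a\<in>pverts A. weak_diameter H (P a) \<le> ereal (2 * (real k + 1) * l)"
      using ex_compressing_quotient[OF H(1) T(2) ne(2) ne(1) ne(3) path_graph_gated[OF T(1)] T(3) l]
        by blast
    have "path_decomposition A T W" using T(1) A(2) by (simp add: path_decomposition_def)
    then have "pathwidth A \<le> k" using pathwidth_le A(3) order_trans by blast
    then show "\<exists>A\<in>{G :: 'a pair_pre_digraph. pair_graph G \<and> pathwidth G \<le> k}.
        \<exists>P. indexed_partition A H P \<and>
        compressing l A H P \<and> (\<forall>a\<in>pverts A. weak_diameter H (P a) \<le> ereal (2 * (real k + 1) * l))"
      using A(1) P by blast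
  qed auto
qed

end
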